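(* Let $(X_k)_{k\in\mathbb Z}$ be a stationary, ergodic, complex valued process with $E(|X_k|^2)<\infty$. Suppose that $(X_k)_{k\in\mathbb Z}$ has singular spectrum, i.e. its spectral measure is singular with respect to the Lebesgue measure on $S^1$. For $\beta\in[0,2\pi)$ let $Y_n^{(\beta)}=(S_n^{(\beta)},e^{in\beta})$, $n\ge1$, be the random walk in $G=\mathbb C\rtimes S^1$ with $$S_n^{(\beta)}=e^{i(n-1)\beta}\sum_{k=0}^{n-1}X_k\,e^{-i\beta k}.$$ Then $(Y_n^{(\beta)})_{n\ge1}$ is recurrent for Lebesgue-almost every $\beta\in[0,2\pi)$.
   Context: Spectral measure: the finite positive Borel measure $m$ on $S^1$ with $E(X_k\overline{X_0})=\int_{S^1}z^k\,dm(z)$ for all $k\in\mathbb Z$. Group: $G=\mathbb C\rtimes S^1=\{(z,e^{i\gamma}):z\in\mathbb C,\gamma\in[0,2\pi)\}$ carries the product topology and the group operation $(z_2,e^{i\gamma_2})\cdot(z_1,e^{i\gamma_1})=(z_2+e^{i\gamma_2}z_1,e^{i(\gamma_2+\gamma_1)})$, with identity $1_G=(0,1)$. With $Z_k=(X_k,e^{i\beta})$ one has $Y_n^{(\beta)}=Z_{n-1}\cdots Z_1\cdot Z_0$; equivalently $S_0^{(\beta)}=0$ and $S_n^{(\beta)}=e^{i\beta}S_{n-1}^{(\beta)}+X_{n-1}$. Recurrence: a stationary $G$-valued process $(Z_k)_{k\in\mathbb Z}$ is realized as $Z_k=f\circ T^k$, where $T$ is an invertible probability-preserving transformation of a standard probability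 space $(X,\mathfrak B,\mu)$ (for instance the shift on the canonical path space) and $f:X\to G$ is Borel. Define $\mathbf f(n,x)=f(T^{n-1}x)\cdots f(Tx)f(x)$ for $n\ge1$, $\mathbf f(0,x)=1_G$, $\mathbf f(n,x)=\mathbf f(-n,T^nx)^{-1}$ for $n<0$. The random walk $Z_{n-1}\cdots Z_0=\mathbf f(n,\cdot)$ is recurrent if for every measurable $B$ with $\mu(B)>0$ and every open neighbourhood $U$ of $1_G$ there is an integer $n\ne0$ with $\mu(B\cap T^{-n}B\cap\{x:\mathbf f(n,x)\in U\})>0$. *)

theory Defs
  imports "HOL-Probability.Probability" "HOL-Algebra.Group"
begin

section \<open>Stationary processes and their spectral measure\<close>

definition stationary_process :: "'a measure \<Rightarrow> (int \<Rightarrow> 'a \<Rightarrow> complex) \<Rightarrow> bool" where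
  "stationary_process M X \<longleftrightarrow>
     (\<forall>k. X k \<in> borel_measurable M) \<and>
     (\<forall>j. distr M (Pi\<^sub>M UNIV (\<lambda>_. borel)) (\<lambda>x k. X (k + j) x)
          = distr M (Pi\<^sub>M UNIV (\<lambda>_. borel)) (\<lambda>x k. X k x))"

definition ergodic_process :: "'a measure \<Rightarrow> (int \<Rightarrow> 'a \<Rightarrow> complex) \<Rightarrow> bool" where
  "ergodic_process M X \<longleftrightarrow>
     (\<forall>A \<in> sets (Pi\<^sub>M UNIV (\<lambda>_::int. borel :: complex measure)).
        {\<omega>. (\<lambda>k. \<omega> (k + 1)) \<in> A} = A \<longrightarrow>
        measure M {x \<in> space M. (\<lambda>k. X k x) \<in> A} \<in> {0, 1})"

definition circle_borel :: "complex measure" where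
  "circle_borel = restrict_space borel (sphere 0 1)"

definition circle_lebesgue :: "complex measure" where
  "circle_lebesgue = distr (restrict_space lborel {0..<2 * pi}) circle_borel cis"

definition spectral_measure :: "'a measure \<Rightarrow> (int \<Rightarrow> 'a \<Rightarrow> complex) \<Rightarrow> complex measure \<Rightarrow> bool" where
  "spectral_measure M X m \<longleftrightarrow>
     finite_measure m \<and> sets m = sets circle_borel \<and>
     (\<forall>k. (LINT x|M. X k x * cnj (X 0 x)) = (LINT z|m. z powi k))"

definition mutually_singular :: "'a measure \<Rightarrow> 'a measure \<Rightarrow> bool" where
  "mutually_singular m l \<longleftrightarrow>
     sets m = sets l \<and> (\<exists>A \<in> sets m. emeasure m A = 0 \<and> emeasure l (space l - A) = 0)"

section \<open>The group of orientation preserving motions of the plane\<close>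

definition motion_group :: "(complex \<times> complex) monoid" where
  "motion_group =
     \<lparr>carrier = UNIV \<times> sphere 0 1,
      mult = (\<lambda>(z2, w2) (z1, w1). (z2 + w2 * z1, w2 * w1)),
      one = (0, 1)\<rparr>"

abbreviation motion_topology :: "(complex \<times> complex) topology" where
  "motion_topology \<equiv> top_of_set (carrier motion_group)"

definition motion_borel :: "(complex \<times> complex) measure" where
  "motion_borel = restrict_space borel (carrier motion_group)"

lemma motion_group_mult [simp]:
  "(z2, w2) \<otimes>\<^bsub>motion_group\<^esub> (z1, w1) = (z2 + w2 * z1, w2 * w1)"
  by (simp add: motion_group_def)

lemma motion_group_one: "\<one>\<^bsub>motion_group\<^esub> = (0, 1)"
  by (simp add: motion_group_def)

lemma motion_group_carrier: "carrier motion_group = UNIV \<times> sphere 0 1"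
  by (simp add: motion_group_def)

lemma group_motion_group: "group motion_group"
proof (rule groupI)
  fix x assume "x \<in> carrier motion_group"
  then obtain z w where x: "x = (z, w)" "norm w = 1"
    by (auto simp: motion_group_carrier)
  then have "w \<noteq> 0" by auto
  with x show "\<exists>y\<in>carrier motion_group. y \<otimes>\<^bsub>motion_group\<^esub> x = \<one>\<^bsub>motion_group\<^esub>"
    by (intro bexI[of _ "(- z / w, 1 / w)"])
       (auto simp: motion_group_one motion_group_carrier norm_divide)
qed (auto simp: motion_group_one motion_group_carrier norm_mult algebra_simps)

section \<open>Recurrence\<close>

text \<open>Products grow to the left: \<open>left_prod z n = z (n - 1) \<cdot> \<dots> \<cdot> z 1 \<cdot> z 0\<close>.\<close>

primrec left_prod :: "(nat \<Rightarrow> complex \<times> complex) \<Rightarrow> nat \<Rightarrow> complex \<times> complex" where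
  "left_prod z 0 = \<one>\<^bsub>motion_group\<^esub>"
| "left_prod z (Suc n) = z n \<otimes>\<^bsub>motion_group\<^esub> left_prod z n"

text \<open>Standard Borel spaces: the Borel sigma-algebras of Polish spaces.\<close>

definition standard_borel :: "'b measure \<Rightarrow> bool" where
  "standard_borel N \<longleftrightarrow>
     (\<exists>\<T>. completely_metrizable_space \<T> \<and> second_countable \<T> \<and> topspace \<T> = space N \<and>
          sets N = sigma_sets (space N) {U. openin \<T> U})"

definition invertible_ppt :: "'b measure \<Rightarrow> ('b \<Rightarrow> 'b) \<Rightarrow> bool" where
  "invertible_ppt N T \<longleftrightarrow>
     prob_space N \<and> T \<in> measurable N N \<and> bij_betw T (space N) (space N) \<and>
     the_inv_into (space N) T \<in> measurable N N \<and> distr N N T = N"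

definition int_iterate :: "'b measure \<Rightarrow> ('b \<Rightarrow> 'b) \<Rightarrow> int \<Rightarrow> 'b \<Rightarrow> 'b" where
  "int_iterate N T n =
     (if n \<ge> 0 then T ^^ nat n else the_inv_into (space N) T ^^ nat (- n))"

definition cocycle ::
  "'b measure \<Rightarrow> ('b \<Rightarrow> 'b) \<Rightarrow> ('b \<Rightarrow> complex \<times> complex) \<Rightarrow> int \<Rightarrow> 'b \<Rightarrow> complex \<times> complex" where
  "cocycle N T f n x =
     (if n \<ge> 0 then left_prod (\<lambda>k. f ((T ^^ k) x)) (nat n)
      else inv\<^bsub>motion_group\<^esub> left_prod (\<lambda>k. f ((T ^^ k) (int_iterate N T n x))) (nat (- n)))"

definition recurrent ::
  "'b measure \<Rightarrow> ('b \<Rightarrow> 'b) \<Rightarrow> ('b \<Rightarrow> complex \<times> complex) \<Rightarrow> bool" where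
  "recurrent N T f \<longleftrightarrow>
     (\<forall>B \<in> sets N. \<forall>U. measure N B > 0 \<and> openin motion_topology U \<and> \<one>\<^bsub>motion_group\<^esub> \<in> U \<longrightarrow>
        (\<exists>n::int. n \<noteq> 0 \<and>
           measure N {x \<in> space N. x \<in> B \<and> int_iterate N T n x \<in> B \<and> cocycle N T f n x \<in> U} > 0))"

text \<open>
  Recurrence is a property of a dynamical realization of a random walk.  The walk
  \<open>(Y n)\<close>, \<open>n \<ge> 1\<close>, on \<open>M\<close> is realized by \<open>(N, T, f)\<close> if the sequence \<open>cocycle N T f n\<close>, \<open>n \<ge> 1\<close>,
  has the same joint law as \<open>(Y n)\<close>.  By stationarity this is the same as equality of the laws
  of the two-sided increment processes; below it is shown that every realization of the increments,
  in particular the shift on the path space, is a realization in this sense.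
\<close>

definition realizes_walk ::
  "'a measure \<Rightarrow> (nat \<Rightarrow> 'a \<Rightarrow> complex \<times> complex) \<Rightarrow>
   'b measure \<Rightarrow> ('b \<Rightarrow> 'b) \<Rightarrow> ('b \<Rightarrow> complex \<times> complex) \<Rightarrow> bool" where
  "realizes_walk M Y N T f \<longleftrightarrow>
     standard_borel N \<and> invertible_ppt N T \<and> f \<in> measurable N motion_borel \<and>
     distr N (Pi\<^sub>M {1..} (\<lambda>_. motion_borel)) (\<lambda>x. \<lambda>n\<in>{1..}. cocycle N T f (int n) x)
     = distr M (Pi\<^sub>M {1..} (\<lambda>_. motion_borel)) (\<lambda>x. \<lambda>n\<in>{1..}. Y n x)"

section \<open>The random walk\<close>

definition rotated_sum :: "(int \<Rightarrow> 'a \<Rightarrow> complex) \<Rightarrow> real \<Rightarrow> nat \<Rightarrow> 'a \<Rightarrow> complex" where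
  "rotated_sum X \<beta> n x = cis ((real n - 1) * \<beta>) * (\<Sum>k<n. X (int k) x * cis (- \<beta> * real k))"

definition rotated_walk :: "(int \<Rightarrow> 'a \<Rightarrow> complex) \<Rightarrow> real \<Rightarrow> nat \<Rightarrow> 'a \<Rightarrow> complex \<times> complex" where
  "rotated_walk X \<beta> n x = (rotated_sum X \<beta> n x, cis (real n * \<beta>))"

lemma rotated_sum_Suc: "rotated_sum X \<beta> (Suc n) x = cis \<beta> * rotated_sum X \<beta> n x + X (int n) x"
proof -
  have 1: "cis (real n * \<beta>) = cis \<beta> * cis ((real n - 1) * \<beta>)"
    by (simp add: cis_mult algebra_simps)
  have 2: "cis (real n * \<beta>) * cis (- \<beta> * real n) = 1"
    by (simp add: cis_mult algebra_simps)
  have "rotated_sum X \<beta> (Suc n) x = cis (real n * \<beta>) * (\<Sum>k<n. X (int k) x * cis (- \<beta> * real k))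
      + X (int n) x * (cis (real n * \<beta>) * cis (- \<beta> * real n))"
    by (simp add: rotated_sum_def algebra_simps)
  then show ?thesis
    unfolding 2 unfolding 1 by (simp add: rotated_sum_def mult.assoc)
qed

lemma rotated_walk_eq_left_prod:
  "rotated_walk X \<beta> n x = left_prod (\<lambda>k. (X (int k) x, cis \<beta>)) n"
proof (induction n)
  case 0
  show ?case by (simp add: rotated_walk_def rotated_sum_def motion_group_one)
next
  case (Suc n)
  have "rotated_walk X \<beta> (Suc n) x = (X (int n) x, cis \<beta>) \<otimes>\<^bsub>motion_group\<^esub> rotated_walk X \<beta> n x"
    unfolding rotated_walk_def
    by (simp add: rotated_sum_Suc cis_mult algebra_simps)
  then show ?case by (simp add: Suc)
qed

section \<open>Realizations of the increments, and the path space\<close>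

lemma space_motion_borel [simp]: "space motion_borel = carrier motion_group"
  by (simp add: motion_borel_def space_restrict_space)

lemma measurable_motion_mult:
  assumes "f \<in> measurable N motion_borel" "g \<in> measurable N motion_borel"
  shows "(\<lambda>x. f x \<otimes>\<^bsub>motion_group\<^esub> g x) \<in> measurable N motion_borel"
proof -
  have f: "f \<in> borel_measurable N" and g: "g \<in> borel_measurable N"
    using assms by (auto simp: motion_borel_def measurable_restrict_space2_iff)
  have eq: "(\<lambda>x. f x \<otimes>\<^bsub>motion_group\<^esub> g x)
      = (\<lambda>x. (fst (f x) + snd (f x) * fst (g x), snd (f x) * snd (g x)))"
    by (auto simp: motion_group_def split: prod.splits)
  have "(\<lambda>x. f x \<otimes>\<^bsub>motion_group\<^esub> g x) \<in> borel_measurable N"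
    unfolding eq using f g
    by (intro borel_measurable_Pair borel_measurable_add borel_measurable_times
         measurable_compose[OF _ borel_measurable_continuous_onI[OF continuous_on_fst[OF continuous_on_id]]]
         measurable_compose[OF _ borel_measurable_continuous_onI[OF continuous_on_snd[OF continuous_on_id]]])
  moreover have "f x \<otimes>\<^bsub>motion_group\<^esub> g x \<in> carrier motion_group" if "x \<in> space N" for x
    using that assms[THEN measurable_space] group_motion_group
    by (auto intro!: monoid.m_closed[OF group.is_monoid])
  ultimately show ?thesis
    by (auto simp: motion_borel_def measurable_restrict_space2_iff)
qed

lemma measurable_left_prod:
  assumes "\<And>k. z k \<in> measurable N motion_borel"
  shows "(\<lambda>x. left_prod (\<lambda>k. z k x) n) \<in> measurable N motion_borel"
proof (induction n)
  case 0
  then show ?case by (auto simp: motion_group_carrier motion_group_one)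
next
  case (Suc n)
  then show ?case using measurable_motion_mult[OF assms] by simp
qed

lemma realizes_walk_of_increments:
  assumes "standard_borel N" "invertible_ppt N T" "f \<in> measurable N motion_borel"
    and X: "\<And>k. X k \<in> borel_measurable M"
    and law: "distr N (Pi\<^sub>M UNIV (\<lambda>_. motion_borel)) (\<lambda>x k. f (int_iterate N T k x))
            = distr M (Pi\<^sub>M UNIV (\<lambda>_. motion_borel)) (\<lambda>x k. (X k x, cis \<beta>))"
  shows "realizes_walk M (rotated_walk X \<beta>) N T f"
proof -
  let ?P = "Pi\<^sub>M (UNIV::int set) (\<lambda>_. motion_borel)"
  let ?Q = "Pi\<^sub>M {1::nat..} (\<lambda>_. motion_borel)"
  let ?F = "\<lambda>w. \<lambda>n\<in>{1..}. left_prod (\<lambda>k. w (int k)) n"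
  have F: "?F \<in> measurable ?P ?Q"
    by (intro measurable_restrict measurable_left_prod) auto
  have pow: "T' ^^ n \<in> measurable N N" if "T' \<in> measurable N N" for T' n
    by (induction n) (use that in \<open>auto intro: measurable_comp\<close>)
  have it: "int_iterate N T k \<in> measurable N N" for k
    using assms(2) by (auto simp: int_iterate_def invertible_ppt_def intro!: pow)
  have m1: "(\<lambda>x k. f (int_iterate N T k x)) \<in> measurable N ?P"
    using measurable_compose[OF it assms(3)] measurable_space[OF measurable_compose[OF it assms(3)]]
    by (intro measurable_PiM_single') auto
  have Z: "(\<lambda>x. (X k x, cis \<beta>)) \<in> measurable M motion_borel" for k
    using X by (auto simp: motion_borel_def measurable_restrict_space2_iff motion_group_carrier
        intro!: borel_measurable_Pair)
  have m2: "(\<lambda>x k. (X k x, cis \<beta>)) \<in> measurable M ?P"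
    using Z by (intro measurable_PiM_single') (auto simp: motion_group_carrier)
  have "distr N ?Q (?F \<circ> (\<lambda>x k. f (int_iterate N T k x))) = distr M ?Q (?F \<circ> (\<lambda>x k. (X k x, cis \<beta>)))"
    using arg_cong[OF law, of "\<lambda>D. distr D ?Q ?F"] F m1 m2 by (simp add: distr_distr)
  moreover have "?F \<circ> (\<lambda>x k. f (int_iterate N T k x)) = (\<lambda>x. \<lambda>n\<in>{1..}. cocycle N T f (int n) x)"
    by (auto simp: fun_eq_iff cocycle_def int_iterate_def restrict_def)
  moreover have "?F \<circ> (\<lambda>x k. (X k x, cis \<beta>)) = (\<lambda>x. \<lambda>n\<in>{1..}. rotated_walk X \<beta> n x)"
    by (auto simp: fun_eq_iff rotated_walk_eq_left_prod restrict_def)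
  ultimately show ?thesis
    using assms unfolding realizes_walk_def by simp
qed

lemma standard_borel_path_space:
  "standard_borel (Pi\<^sub>M (UNIV::int set) (\<lambda>_. motion_borel))" (is "standard_borel ?P")
proof -
  let ?S = "Pi UNIV (\<lambda>_. carrier motion_group) :: (int \<Rightarrow> complex \<times> complex) set"
  let ?R = "restrict_space borel ?S"
  have sp: "space ?P = ?S" by (auto simp: space_PiM PiE_def)
  have sub: "sets B \<subseteq> sets A" if m: "(\<lambda>w. w) \<in> measurable A B" and s: "space A = space B"
    for A B :: "(int \<Rightarrow> complex \<times> complex) measure"
  proof
    fix U assume U: "U \<in> sets B"
    have "(\<lambda>w. w) -` U \<inter> space A \<in> sets A" using measurable_sets[OF m U] .
    moreover have "(\<lambda>w. w) -` U \<inter> space A = U" using sets.sets_into_space[OF U] s by auto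
    ultimately show "U \<in> sets A" by simp
  qed
  have cl: "closed ?S"
  proof -
    have "?S = (\<Inter>k. (\<lambda>w. w k) -` (UNIV \<times> sphere 0 1))"
      by (auto simp: motion_group_carrier Pi_def)
    moreover have "closed ((\<lambda>w::int \<Rightarrow> complex \<times> complex. w k) -` (UNIV \<times> sphere 0 1))" for k
      by (intro closed_vimage closed_Times continuous_on_product_coordinates) auto
    ultimately show ?thesis by auto
  qed
  have coord: "(\<lambda>w. w k) \<in> measurable ?R motion_borel" for k
  proof -
    have "(\<lambda>w. w k) \<in> borel_measurable (borel :: (int \<Rightarrow> complex \<times> complex) measure)"
      by (intro borel_measurable_continuous_onI continuous_on_product_coordinates)
    then show ?thesis
      by (auto simp: motion_borel_def measurable_restrict_space2_iff space_restrict_space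
          intro: measurable_restrict_space1)
  qed
  have "(\<lambda>w. w) \<in> measurable ?R ?P"
    using coord by (intro measurable_PiM_single') (auto simp: space_restrict_space PiE_def)
  then have 1: "sets ?P \<subseteq> sets ?R"
    by (rule sub) (use sp in \<open>auto simp: space_restrict_space\<close>)
  have inc: "(\<lambda>g. g) \<in> measurable motion_borel borel"
    by (auto simp: motion_borel_def intro: measurable_restrict_space1)
  have "(\<lambda>w. w) \<in> measurable ?P (Pi\<^sub>M UNIV (\<lambda>_. borel))"
    by (intro measurable_PiM_single' measurable_compose[OF _ inc] measurable_component_singleton) auto
  then have "(\<lambda>w. w) \<in> borel_measurable ?P"
    by (simp add: measurable_cong_sets[OF refl sets_PiM_equal_borel])
  then have "(\<lambda>w. w) \<in> measurable ?P ?R"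
    using sp by (auto simp: measurable_restrict_space2_iff)
  then have 2: "sets ?R \<subseteq> sets ?P"
    by (rule sub) (use sp in \<open>auto simp: space_restrict_space\<close>)
  have "sets ?P = sigma_sets ?S {U. openin (top_of_set ?S) U}"
  proof -
    have "sets ?R = sigma_sets ?S ((\<inter>) ?S ` {U. open U})"
      using sigma_sets_Int[of ?S UNIV "{U. open U}"] borel_closed[OF cl]
      by (simp add: borel_def sets_restrict_space)
    also have "(\<inter>) ?S ` {U. open U} = {U. openin (top_of_set ?S) U}"
      by (auto simp: openin_open)
    finally show ?thesis using 1 2 by auto
  qed
  moreover have "completely_metrizable_space (top_of_set ?S)"
    by (rule completely_metrizable_space_closedin
        [OF completely_metrizable_space_euclidean cl[unfolded closed_closedin]])
  moreover have "second_countable (top_of_set ?S)"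
  proof (intro second_countable_subtopology)
    obtain B :: "(int \<Rightarrow> complex \<times> complex) set set" where B: "countable B" "topological_basis B"
      using ex_countable_basis by blast
    have "\<forall>V\<in>B. open V" using B topological_basis_open by blast
    moreover have "\<exists>V\<in>B. x \<in> V \<and> V \<subseteq> U" if "open U" "x \<in> U" for U x
      using topological_basisE[OF B(2) that] by metis
    ultimately show "second_countable (euclidean :: (int \<Rightarrow> complex \<times> complex) topology)"
      unfolding second_countable_def using B(1) by (intro exI[of _ B]) simp
  qed
  ultimately show ?thesis
    unfolding standard_borel_def sp by (intro exI[of _ "top_of_set ?S"]) auto
qed

lemma path_space_realizes_walk:
  fixes X :: "int \<Rightarrow> 'a \<Rightarrow> complex" and \<beta> :: real
  assumes "prob_space M" and st: "stationary_process M X"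
  defines "N \<equiv> distr M (Pi\<^sub>M UNIV (\<lambda>_. motion_borel)) (\<lambda>x k. (X k x, cis \<beta>))"
  shows "realizes_walk M (rotated_walk X \<beta>) N (\<lambda>\<omega> k. \<omega> (k + 1)) (\<lambda>\<omega>. \<omega> 0)"
proof -
  let ?P = "Pi\<^sub>M (UNIV::int set) (\<lambda>_. motion_borel)"
  let ?Q = "Pi\<^sub>M (UNIV::int set) (\<lambda>_. borel :: complex measure)"
  let ?Z = "\<lambda>x k. (X k x, cis \<beta>)"
  let ?T = "\<lambda>(\<omega> :: int \<Rightarrow> complex \<times> complex) k. \<omega> (k + 1)"
  let ?S = "\<lambda>(\<omega> :: int \<Rightarrow> complex \<times> complex) k. \<omega> (k - 1)"
  have X: "X k \<in> borel_measurable M" for k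
    using st by (auto simp: stationary_process_def)
  have sN: "sets N = sets ?P" and spN: "space N = Pi UNIV (\<lambda>_. carrier motion_group)"
    by (auto simp: N_def space_PiM PiE_def)
  have mNN: "measurable N N = measurable ?P ?P"
    by (rule measurable_cong_sets[OF sN sN])
  have emb: "(\<lambda>w k. (w k, cis \<beta>)) \<in> measurable ?Q ?P"
    by (intro measurable_PiM_single')
      (auto simp: motion_borel_def measurable_restrict_space2_iff motion_group_carrier
        space_restrict_space intro!: borel_measurable_Pair)
  have mX: "(\<lambda>x k. X (k + j) x) \<in> measurable M ?Q" for j
    by (rule measurable_PiM_single') (simp_all add: X)
  have Z: "?Z \<in> measurable M ?P"
    using measurable_compose[OF mX[of 0] emb] by simp
  have proj: "(\<lambda>\<omega>. \<omega> (g k)) \<in> measurable ?P motion_borel" for g :: "int \<Rightarrow> int" and k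
    by (rule measurable_component_singleton) simp
  have shift: "(\<lambda>\<omega> k. \<omega> (g k)) \<in> measurable ?P ?P" for g :: "int \<Rightarrow> int"
    by (intro measurable_PiM_single' proj) (auto simp: space_PiM PiE_def)
  have ST: "the_inv_into (space N) ?T \<omega> = ?S \<omega>" if "\<omega> \<in> space N" for \<omega>
  proof (rule the_inv_into_f_eq)
    show "inj_on ?T (space N)"
    proof (rule inj_onI)
      fix x y :: "int \<Rightarrow> complex \<times> complex"
      assume "?T x = ?T y"
      then have "x ((k - 1) + 1) = y ((k - 1) + 1)" for k by meson
      then show "x = y" by auto
    qed
  qed (use that in \<open>auto simp: spN\<close>)
  have bij: "bij_betw ?T (space N) (space N)"
    by (rule bij_betw_byWitness[where f' = ?S]) (auto simp: spN)
  have inv: "the_inv_into (space N) ?T \<in> measurable N N"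
    using shift[of "\<lambda>k. k - 1", folded mNN] measurable_cong[of N "the_inv_into (space N) ?T" ?S N, OF ST]
    by blast
  have "distr N ?P ?T = distr M ?P (?T \<circ> ?Z)"
    unfolding N_def by (rule distr_distr[OF shift Z])
  also have "\<dots> = distr (distr M ?Q (\<lambda>x k. X (k + 1) x)) ?P (\<lambda>w k. (w k, cis \<beta>))"
    unfolding distr_distr[OF emb mX] by (simp add: comp_def)
  also have "distr M ?Q (\<lambda>x k. X (k + 1) x) = distr M ?Q (\<lambda>x k. X k x)"
    using st by (simp add: stationary_process_def)
  also have "distr \<dots> ?P (\<lambda>w k. (w k, cis \<beta>)) = N"
    using distr_distr[OF emb mX[of 0]] by (simp add: N_def comp_def)
  finally have "distr N N ?T = N"
    using sN by (simp cong: distr_cong)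
  moreover have "prob_space N"
    unfolding N_def using Z assms(1) by (intro prob_space.prob_space_distr)
  ultimately have ppt: "invertible_ppt N ?T"
    using bij inv shift[of "\<lambda>k. k + 1", folded mNN] unfolding invertible_ppt_def by blast
  have "(?T ^^ n) \<omega> = (\<lambda>k. \<omega> (k + int n))" for n \<omega>
    by (induction n) (auto simp: algebra_simps)
  moreover have "(the_inv_into (space N) ?T ^^ n) \<omega> = (\<lambda>k. \<omega> (k - int n))"
    if "\<omega> \<in> space N" for n \<omega>
  proof (induction n)
    case (Suc n)
    have "(\<lambda>k. \<omega> (k - int n)) \<in> space N" using that by (auto simp: spN)
    then show ?case using Suc by (simp add: ST algebra_simps)
  qed simp
  ultimately have it: "int_iterate N ?T k \<omega> = (\<lambda>j. \<omega> (j + k))" if "\<omega> \<in> space N" for k \<omega>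
    using that by (simp add: int_iterate_def)
  have "distr N ?P (\<lambda>\<omega> k. int_iterate N ?T k \<omega> 0) = distr N N (\<lambda>\<omega>. \<omega>)"
    using sN by (intro distr_cong) (auto simp: it)
  also have "\<dots> = distr M ?P ?Z"
    by (simp add: distr_id2 N_def[symmetric])
  finally have law: "distr N ?P (\<lambda>\<omega> k. int_iterate N ?T k \<omega> 0) = distr M ?P ?Z" .
  have "standard_borel N"
    using standard_borel_path_space sN sets_eq_imp_space_eq[OF sN] by (simp add: standard_borel_def)
  moreover have "(\<lambda>\<omega>. \<omega> 0) \<in> measurable N motion_borel"
    using proj[of "\<lambda>k. k" 0] by (simp add: measurable_cong_sets[OF sN refl])
  ultimately show ?thesis
    using ppt X law by (intro realizes_walk_of_increments)
qed

end

theory Submission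
  imports Defs
begin

text \<open>
  Let \<open>a\<^sub>n(\<beta>) = n\<^sup>-\<^sup>2 \<Sum>\<^bsub>k<n\<^esub> E\<bar>S\<^sub>k\<bar>\<^sup>2\<close>. By the spectral isometry this is an integral of Fejer type
  kernels against the spectral measure. A singular spectral measure is carried, up to a mass
  \<open>\<epsilon>\<close>, by a compact null set; that part contributes \<open>O(1/n)\<close> at every \<open>\<beta>\<close>
  outside the compact set, while the rest has mean at most \<open>2\<pi>\<epsilon>\<close> over \<open>\<beta>\<close>. By Fatou's lemma,
  \<open>liminf a\<^sub>n(\<beta>) = 0\<close> for almost every \<open>\<beta>\<close>.

  For such \<open>\<beta>\<close>, at infinitely many times \<open>n\<close> most of the walk up to time \<open>n\<close> lies in the
  disc of radius \<open>\<delta> \<surd>n\<close>. If the walk were not recurrent, the positions at the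
  visits to some set \<open>B\<close> of positive measure would be uniformly separated, so the disc would contain
  only \<open>O(\<delta>\<^sup>2 n + 1)\<close> of them, whereas on average \<open>n \<mu>(B)\<close> visits occur.
\<close>

section \<open>A recurrence criterion\<close>

lemma card_floor_interval_le:
  fixes r :: real
  assumes "r \<ge> 0"
  shows "real (card {\<lfloor>- r\<rfloor>..\<lfloor>r\<rfloor>}) \<le> 2 * r + 2"
proof -
  have "\<lfloor>- r\<rfloor> \<le> \<lfloor>r\<rfloor>" using assms by (intro floor_mono) auto
  then have "real (card {\<lfloor>- r\<rfloor>..\<lfloor>r\<rfloor>}) = of_int \<lfloor>r\<rfloor> - of_int \<lfloor>- r\<rfloor> + 1"
    by simp
  then show ?thesis by linarith
qed

lemma abs_diff_less_of_floor_eq: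
  fixes a b e :: real
  assumes "e > 0" "\<lfloor>2 * a / e\<rfloor> = \<lfloor>2 * b / e\<rfloor>"
  shows "\<bar>a - b\<bar> < e / 2"
proof -
  have "2 * a / e < 2 * b / e + 1" "2 * b / e < 2 * a / e + 1" using assms(2) by linarith+
  then have "a < b + e / 2" "b < a + e / 2" using assms(1) by (simp_all add: field_simps)
  then show ?thesis by linarith
qed

lemma norm_diff_less_of_floor_eq:
  fixes a b :: complex
  assumes "e > 0" "\<lfloor>2 * Re a / e\<rfloor> = \<lfloor>2 * Re b / e\<rfloor>" "\<lfloor>2 * Im a / e\<rfloor> = \<lfloor>2 * Im b / e\<rfloor>"
  shows "cmod (a - b) < e"
  using cmod_le[of "a - b"] abs_diff_less_of_floor_eq[OF assms(1,2)] abs_diff_less_of_floor_eq[OF assms(1,3)]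
  by simp

lemma floor_scaled_mem:
  fixes a :: real
  assumes "e > 0" "\<bar>a\<bar> \<le> R"
  shows "\<lfloor>2 * a / e\<rfloor> \<in> {\<lfloor>- (2 * R / e)\<rfloor>..\<lfloor>2 * R / e\<rfloor>}"
proof -
  have "2 * a / e \<le> 2 * R / e" "- (2 * R / e) \<le> 2 * a / e"
    using assms by (auto simp: field_simps)
  then show ?thesis by (auto intro: floor_mono)
qed

text \<open>Two points in one cell of a square grid of mesh \<open>e / 2\<close> are less than
  \<open>e\<close> apart, so a pair of cells, one for \<open>u\<close> and one for \<open>w\<close>,
  holds at most one index. Since \<open>w\<close> stays in the unit disc, only the number of cells
  for \<open>u\<close> grows with \<open>R\<close>, and it does so quadratically.\<close>

lemma card_separated_le:
  fixes u w :: "'i \<Rightarrow> complex"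
  assumes "e > 0" "R \<ge> 0"
    and u: "\<And>i. i \<in> I \<Longrightarrow> cmod (u i) \<le> R" and w: "\<And>i. i \<in> I \<Longrightarrow> cmod (w i) \<le> 1"
    and sep: "\<And>i j. i \<in> I \<Longrightarrow> j \<in> I \<Longrightarrow> i \<noteq> j \<Longrightarrow> e \<le> cmod (u i - u j) \<or> e \<le> cmod (w i - w j)"
  shows "real (card I) \<le> (4 * R / e + 2)\<^sup>2 * (4 / e + 2)\<^sup>2"
proof -
  define F where "F r = {\<lfloor>- (2 * r / e)\<rfloor>..\<lfloor>2 * r / e\<rfloor>}" for r
  define h where "h i = ((\<lfloor>2 * Re (u i) / e\<rfloor>, \<lfloor>2 * Im (u i) / e\<rfloor>), (\<lfloor>2 * Re (w i) / e\<rfloor>, \<lfloor>2 * Im (w i) / e\<rfloor>))" for i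
  let ?G = "(F R \<times> F R) \<times> (F 1 \<times> F 1)"
  have "inj_on h I"
  proof (rule inj_onI, rule ccontr)
    fix i j assume "i \<in> I" "j \<in> I" "h i = h j" "i \<noteq> j"
    then show False
      using sep[of i j] norm_diff_less_of_floor_eq[OF assms(1), of "u i" "u j"]
        norm_diff_less_of_floor_eq[OF assms(1), of "w i" "w j"]
      by (auto simp: h_def)
  qed
  moreover have "h ` I \<subseteq> ?G"
  proof (rule image_subsetI)
    fix i assume i: "i \<in> I"
    have "\<bar>Re (u i)\<bar> \<le> R" "\<bar>Im (u i)\<bar> \<le> R" "\<bar>Re (w i)\<bar> \<le> 1" "\<bar>Im (w i)\<bar> \<le> 1"
      using u[OF i] w[OF i] abs_Re_le_cmod[of "u i"] abs_Im_le_cmod[of "u i"] abs_Re_le_cmod[of "w i"]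
        abs_Im_le_cmod[of "w i"] by linarith+
    then show "h i \<in> ?G"
      unfolding h_def F_def using floor_scaled_mem[OF assms(1)] by blast
  qed
  moreover have "finite ?G" by (simp add: F_def)
  ultimately have "card I \<le> card ?G" by (rule card_inj_on_le)
  then have "real (card I) \<le> (real (card (F R)))\<^sup>2 * (real (card (F 1)))\<^sup>2"
    by (simp add: card_cartesian_product power2_eq_square flip: of_nat_mult)
  also have "\<dots> \<le> (4 * R / e + 2)\<^sup>2 * (4 / e + 2)\<^sup>2"
    using card_floor_interval_le[of "2 * R / e"] card_floor_interval_le[of "2 * 1 / e"] assms(1,2)
    unfolding F_def by (intro mult_mono power_mono) auto
  finally show ?thesis .
qed

section \<open>Cocycle identity and invariance under iterates\<close>

lemma left_prod_carrier:
  assumes "\<And>i. z i \<in> carrier motion_group"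
  shows "left_prod z n \<in> carrier motion_group"
proof -
  interpret group motion_group by (rule group_motion_group)
  show ?thesis by (induction n) (use assms in auto)
qed

text \<open>Lets the step between two visits be read as the walk restarted at the earlier
  one.\<close>

lemma left_prod_add:
  assumes "\<And>i. z i \<in> carrier motion_group"
  shows "left_prod z (n + k) = left_prod (\<lambda>i. z (n + i)) k \<otimes>\<^bsub>motion_group\<^esub> left_prod z n"
proof -
  interpret group motion_group by (rule group_motion_group)
  show ?thesis
    by (induction k) (use assms left_prod_carrier in \<open>auto simp: m_assoc\<close>)
qed

lemma measurable_funpow:
  assumes "T \<in> measurable N N"
  shows "T ^^ n \<in> measurable N N"
  by (induction n) (use assms in \<open>auto intro: measurable_comp\<close>)

lemma distr_funpow:
  assumes "T \<in> measurable N N" "distr N N T = N"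
  shows "distr N N (T ^^ n) = N"
proof (induction n)
  case (Suc n)
  have "distr N N (T ^^ Suc n) = distr (distr N N (T ^^ n)) N T"
    unfolding distr_distr[OF assms(1) measurable_funpow[OF assms(1)]] by simp
  then show ?case unfolding Suc assms(2) .
qed (simp add: distr_id2 id_def)

text \<open>A bad pair \<open>B, U\<close> forces the visit times \<open>n\<close> to \<open>B\<close> to have separated
  coordinates \<open>(w\<^sub>n\<inverse> z\<^sub>n, w\<^sub>n)\<close>, where \<open>(z\<^sub>n, w\<^sub>n)\<close> is the walk, so there
  are at most \<open>O(R\<^sup>2)\<close> of them with \<open>\<bar>z\<^sub>n\<bar> \<le> R\<close>.\<close>

lemma card_visits_le:
  fixes z :: "nat \<Rightarrow> complex \<times> complex"
  assumes "e > 0" "R \<ge> 0" and f: "\<And>i. z i \<in> carrier motion_group"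
    and sep: "\<And>i j. i \<in> I \<Longrightarrow> j \<in> I \<Longrightarrow> i < j \<Longrightarrow>
       e \<le> cmod (fst (left_prod (\<lambda>l. z (i + l)) (j - i))) \<or>
       e \<le> cmod (snd (left_prod (\<lambda>l. z (i + l)) (j - i)) - 1)"
    and R: "\<And>i. i \<in> I \<Longrightarrow> cmod (fst (left_prod z i)) \<le> R"
  shows "real (card I) \<le> (4 * R / e + 2)\<^sup>2 * (4 / e + 2)\<^sup>2"
proof -
  \<comment> \<open>Dividing by the rotation part cancels the factor \<open>b\<close>:
    \<open>u j - u i\<close> becomes \<open>a / (b * w i)\<close>, of modulus \<open>cmod a\<close>.
    The difference of the positions themselves contains \<open>b - 1\<close> times the position at
    time \<open>i\<close>, which need not be small far from the origin.\<close>
  define u where "u i = fst (left_prod z i) / snd (left_prod z i)" for i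
  define w where "w i = snd (left_prod z i)" for i
  have w1: "cmod (w i) = 1" for i
    using left_prod_carrier[where z = z and n = i] f by (auto simp: w_def motion_group_carrier)
  have *: "e \<le> cmod (u j - u i) \<or> e \<le> cmod (w j - w i)" if "i \<in> I" "j \<in> I" "i < j" for i j
  proof -
    obtain a b where ab: "left_prod (\<lambda>l. z (i + l)) (j - i) = (a, b)" by fastforce
    have nz: "w i \<noteq> 0" using w1[of i] by auto
    have b1: "cmod b = 1"
      using left_prod_carrier[of "\<lambda>l. z (i + l)" "j - i"] f ab by (auto simp: motion_group_carrier)
    then have bz: "b \<noteq> 0" by auto
    have "left_prod z j = (a, b) \<otimes>\<^bsub>motion_group\<^esub> left_prod z i"
      using left_prod_add[of z i "j - i"] f that(3) ab by simp
    then have j: "left_prod z j = (a + b * (u i * w i), b * w i)"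
      using nz by (cases "left_prod z i") (simp add: u_def w_def)
    have "u j - u i = a / (b * w i)"
      using nz bz unfolding u_def[of j] j by (simp add: field_simps)
    then have "cmod (u j - u i) = cmod a"
      using b1 w1[of i] by (simp add: norm_divide norm_mult)
    moreover have "cmod (w j - w i) = cmod ((b - 1) * w i)"
      unfolding w_def[of j] j by (simp add: algebra_simps)
    then have "cmod (w j - w i) = cmod (b - 1)"
      using w1[of i] by (simp add: norm_mult)
    ultimately show ?thesis using sep[OF that] ab by simp
  qed
  show ?thesis
  proof (rule card_separated_le[OF assms(1,2), where u = u and w = w])
    show "cmod (u i) \<le> R" if "i \<in> I" for i
      using R[OF that] w1[of i] by (simp add: u_def w_def norm_divide)
    show "e \<le> cmod (u i - u j) \<or> e \<le> cmod (w i - w j)" if "i \<in> I" "j \<in> I" "i \<noteq> j" for i j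
      using that *[of i j] *[of j i] by (cases "i < j") (auto simp: norm_minus_commute)
  qed (simp add: w1)
qed

lemma motion_neighbourhood:
  assumes "openin motion_topology U" "\<one>\<^bsub>motion_group\<^esub> \<in> U"
  obtains e where "e > 0"
    "\<And>g. g \<in> carrier motion_group \<Longrightarrow> cmod (fst g) < e \<Longrightarrow> cmod (snd g - 1) < e \<Longrightarrow> g \<in> U"
proof -
  obtain V where V: "open V" "U = carrier motion_group \<inter> V"
    using assms(1) by (auto simp: openin_open)
  then have "(0, 1) \<in> V" using assms(2) by (simp add: motion_group_one)
  then obtain A B where AB: "open A" "open B" "0 \<in> A" "1 \<in> B" "A \<times> B \<subseteq> V"
    using open_prod_elim[OF V(1)] by (metis mem_Sigma_iff)
  obtain a where a: "a > 0" "ball 0 a \<subseteq> A" using AB open_contains_ball by blast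
  obtain b where b: "b > 0" "ball 1 b \<subseteq> B" using AB open_contains_ball by blast
  show thesis
  proof (rule that[of "min a b"])
    fix g assume g: "g \<in> carrier motion_group" "cmod (fst g) < min a b" "cmod (snd g - 1) < min a b"
    then have "fst g \<in> A" "snd g \<in> B"
      using a b by (auto simp: dist_norm norm_minus_commute)
    then show "g \<in> U" using g V(2) AB(5) by (cases g) auto
  qed (use a b in auto)
qed

text \<open>Visits to \<open>B\<close> up to time \<open>n\<close> are counted in two ways:
  invariance gives their mean, while the packing bound controls those inside a disc and Chebyshev's
  inequality those outside. A single large good \<open>n\<close> yields the contradiction, hence
  smallness is only asked for frequently.\<close>

lemma recurrent_of_second_moments:
  assumes ppt: "invertible_ppt N T" and f: "f \<in> measurable N motion_borel"
    and small: "\<And>\<eta>. \<eta> > 0 \<Longrightarrow> \<exists>\<^sub>F n in sequentially.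
       (\<Sum>k<n. \<integral>\<^sup>+x. ennreal ((cmod (fst (left_prod (\<lambda>i. f ((T ^^ i) x)) k)))\<^sup>2) \<partial>N) \<le> ennreal (\<eta> * (real n)\<^sup>2)"
  shows "recurrent N T f"
  unfolding recurrent_def
proof (intro ballI allI impI, rule ccontr)
  fix B U
  assume B: "B \<in> sets N"
  assume "0 < measure N B \<and> openin motion_topology U \<and> \<one>\<^bsub>motion_group\<^esub> \<in> U"
  then have pos: "0 < measure N B" and U: "openin motion_topology U" "\<one>\<^bsub>motion_group\<^esub> \<in> U" by auto
  assume nrec: "\<not> (\<exists>n. n \<noteq> 0 \<and>
     0 < measure N {x \<in> space N. x \<in> B \<and> int_iterate N T n x \<in> B \<and> cocycle N T f n x \<in> U})"
  have T: "T \<in> measurable N N" "distr N N T = N" and "prob_space N"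
    using ppt by (auto simp: invertible_ppt_def)
  interpret prob_space N by fact
  define g where "g n x = left_prod (\<lambda>i. f ((T ^^ i) x)) n" for n x
  have Tn [measurable]: "T ^^ n \<in> measurable N N" for n by (rule measurable_funpow[OF T(1)])
  have g [measurable]: "g n \<in> measurable N motion_borel" for n
    unfolding g_def by (rule measurable_left_prod) (rule measurable_compose[OF Tn f])
  have inc: "(\<lambda>g. g) \<in> measurable motion_borel borel"
    by (auto simp: motion_borel_def intro: measurable_restrict_space1)
  have gb [measurable]: "(\<lambda>x. fst (g n x)) \<in> borel_measurable N" for n
    using measurable_compose[OF measurable_compose[OF g inc]
        borel_measurable_continuous_onI[OF continuous_on_fst[OF continuous_on_id]]] by simp
  obtain e where e: "e > 0"
    "\<And>g. g \<in> carrier motion_group \<Longrightarrow> cmod (fst g) < e \<Longrightarrow> cmod (snd g - 1) < e \<Longrightarrow> g \<in> U"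
    using motion_neighbourhood[OF U] by blast
  have Us: "U \<in> sets motion_borel"
    using U(1) by (auto simp: openin_open motion_borel_def sets_restrict_space)
  define D where "D n = {x \<in> space N. x \<in> B \<and> (T ^^ n) x \<in> B \<and> g n x \<in> U}" for n
  have D: "D n \<in> null_sets N" if "n > 0" for n
  proof -
    have "D n = B \<inter> ((T ^^ n) -` B \<inter> space N) \<inter> (g n -` U \<inter> space N)"
      by (auto simp: D_def)
    then have "D n \<in> sets N"
      using measurable_sets[OF Tn B] measurable_sets[OF g Us] B by auto
    moreover have "measure N (D n) = 0"
      using nrec that
      by (auto simp: zero_less_measure_iff D_def g_def cocycle_def int_iterate_def dest!: spec[of _ "int n"])
    ultimately show ?thesis by (auto simp: null_sets_def emeasure_eq_measure)
  qed
  \<comment> \<open>Invariance carries the null sets \<open>D n\<close> along the orbit. Outside one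
    null set, no two visits to \<open>B\<close> at times \<open>i < j\<close> are joined by a group
    element in \<open>U\<close>.\<close>
  have "AE x in N. (T ^^ i) x \<notin> D n" if "n > 0" for i n
  proof -
    have "AE y in distr N N (T ^^ i). y \<notin> D n"
      unfolding distr_funpow[OF T] by (rule AE_not_in[OF D[OF that]])
    then show ?thesis by (rule AE_distrD[OF Tn])
  qed
  then have "AE x in N. \<forall>i n. n > 0 \<longrightarrow> (T ^^ i) x \<notin> D n"
    by (auto simp: AE_all_countable)
  \<comment> \<open>A visit inside the disc of radius \<open>R\<close> is charged to the packing
    bound, one outside to its squared distance from the origin divided by \<open>R\<^sup>2\<close>,
    which is at least 1.\<close>
  then have count: "AE x in N. (\<Sum>k<n. indicator B ((T ^^ k) x)) \<le>
      ennreal ((4 * R / e + 2)\<^sup>2 * (4 / e + 2)\<^sup>2) + (\<Sum>k<n. ennreal ((cmod (fst (g k x)))\<^sup>2) * ennreal (1 / R\<^sup>2))"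
    if R: "R > 0" for R n
  proof (rule AE_mp, intro AE_I2 impI)
    fix x assume x: "x \<in> space N" and nD: "\<forall>i n. n > 0 \<longrightarrow> (T ^^ i) x \<notin> D n"
    have Tx: "(T ^^ i) x \<in> space N" for i using measurable_space[OF Tn x] .
    have fc: "f ((T ^^ i) x) \<in> carrier motion_group" for i
      using measurable_space[OF f Tx] by simp
    define I where "I = {k. k < n \<and> (T ^^ k) x \<in> B \<and> cmod (fst (g k x)) \<le> R}"
    have I: "finite I" "I \<subseteq> {..<n}" by (auto simp: I_def)
    have "real (card I) \<le> (4 * R / e + 2)\<^sup>2 * (4 / e + 2)\<^sup>2"
    proof (rule card_visits_le[where z = "\<lambda>i. f ((T ^^ i) x)"])
      fix i j assume ij: "i \<in> I" "j \<in> I" "i < j"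
      have sh: "(T ^^ (i + l)) x = (T ^^ l) ((T ^^ i) x)" for l
        by (metis add.commute comp_apply funpow_add)
      have "(T ^^ i) x \<notin> D (j - i)" using nD ij by simp
      then have "g (j - i) ((T ^^ i) x) \<notin> U"
        using ij Tx sh[of "j - i"] by (auto simp: D_def I_def)
      moreover have "g (j - i) ((T ^^ i) x) \<in> carrier motion_group"
        using measurable_space[OF g Tx] by simp
      ultimately show "e \<le> cmod (fst (left_prod (\<lambda>l. f ((T ^^ (i + l)) x)) (j - i))) \<or>
         e \<le> cmod (snd (left_prod (\<lambda>l. f ((T ^^ (i + l)) x)) (j - i)) - 1)"
        using e(2)[of "g (j - i) ((T ^^ i) x)"] unfolding sh g_def by force
    qed (use e R fc in \<open>auto simp: I_def g_def\<close>)
    then have cI: "of_nat (card I) \<le> ennreal ((4 * R / e + 2)\<^sup>2 * (4 / e + 2)\<^sup>2)"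
      by (metis ennreal_leI ennreal_of_nat_eq_real_of_nat)
    have "(\<Sum>k<n. indicator B ((T ^^ k) x)) \<le>
       (\<Sum>k<n. indicator I k + ennreal ((cmod (fst (g k x)))\<^sup>2) * ennreal (1 / R\<^sup>2))"
    proof (rule sum_mono)
      fix k assume k: "k \<in> {..<n}"
      show "indicator B ((T ^^ k) x) \<le> indicator I k + ennreal ((cmod (fst (g k x)))\<^sup>2) * ennreal (1 / R\<^sup>2)"
      proof (cases "cmod (fst (g k x)) \<le> R")
        case True
        then show ?thesis using k by (auto simp: I_def indicator_def)
      next
        case False
        then have "1 \<le> (cmod (fst (g k x)))\<^sup>2 * (1 / R\<^sup>2)" using R by (simp add: power_mono)
        then have "1 \<le> ennreal ((cmod (fst (g k x)))\<^sup>2) * ennreal (1 / R\<^sup>2)"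
          by (metis ennreal_leI ennreal_1 ennreal_mult' zero_le_power2)
        then show ?thesis
          by (auto simp: indicator_def intro: order_trans[OF _ add_increasing])
      qed
    qed
    also have "\<dots> = (\<Sum>k<n. indicator I k) + (\<Sum>k<n. ennreal ((cmod (fst (g k x)))\<^sup>2) * ennreal (1 / R\<^sup>2))"
      by (rule sum.distrib)
    also have "(\<Sum>k<n. indicator I k) = (of_nat (card I) :: ennreal)"
      using I by (subst sum.mono_neutral_cong_right[of "{..<n}" I _ "\<lambda>_. 1"]) (auto simp: indicator_def)
    finally show "(\<Sum>k<n. indicator B ((T ^^ k) x)) \<le>
      ennreal ((4 * R / e + 2)\<^sup>2 * (4 / e + 2)\<^sup>2) + (\<Sum>k<n. ennreal ((cmod (fst (g k x)))\<^sup>2) * ennreal (1 / R\<^sup>2))"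
      using cI by (meson add_right_mono order_trans)
  qed
  have main: "ennreal (real n * measure N B) \<le> ennreal ((4 * R / e + 2)\<^sup>2 * (4 / e + 2)\<^sup>2)
     + (\<Sum>k<n. \<integral>\<^sup>+x. ennreal ((cmod (fst (g k x)))\<^sup>2) \<partial>N) * ennreal (1 / R\<^sup>2)" if R: "R > 0" for R n
  proof -
    have ind: "(\<integral>\<^sup>+x. indicator B ((T ^^ k) x) \<partial>N) = ennreal (measure N B)" for k
    proof -
      have "(\<integral>\<^sup>+x. indicator B x \<partial>distr N N (T ^^ k)) = (\<integral>\<^sup>+x. indicator B ((T ^^ k) x) \<partial>N)"
        by (rule nn_integral_distr[OF Tn]) (use B in simp)
      then show ?thesis unfolding distr_funpow[OF T] using B by (simp add: emeasure_eq_measure)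
    qed
    have "ennreal (real n * measure N B) = (\<Sum>k<n. \<integral>\<^sup>+x. indicator B ((T ^^ k) x) \<partial>N)"
      unfolding ind by (simp add: ennreal_mult ennreal_of_nat_eq_real_of_nat)
    also have "\<dots> = (\<integral>\<^sup>+x. (\<Sum>k<n. indicator B ((T ^^ k) x)) \<partial>N)"
      using B by (subst nn_integral_sum) auto
    also have "\<dots> \<le> (\<integral>\<^sup>+x. ennreal ((4 * R / e + 2)\<^sup>2 * (4 / e + 2)\<^sup>2) +
       (\<Sum>k<n. ennreal ((cmod (fst (g k x)))\<^sup>2) * ennreal (1 / R\<^sup>2)) \<partial>N)"
      by (rule nn_integral_mono_AE[OF count[OF R]])
    also have "\<dots> = ennreal ((4 * R / e + 2)\<^sup>2 * (4 / e + 2)\<^sup>2) +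
       (\<Sum>k<n. (\<integral>\<^sup>+x. ennreal ((cmod (fst (g k x)))\<^sup>2) \<partial>N) * ennreal (1 / R\<^sup>2))"
      by (subst nn_integral_add) (auto simp: nn_integral_sum nn_integral_multc emeasure_space_1)
    finally show ?thesis by (simp add: sum_distrib_right)
  qed
  define \<mu> where "\<mu> = measure N B"
  define c where "c = 4 / e + 2"
  \<comment> \<open>Chosen so that with \<open>R = \<delta> * sqrt n\<close> the packing term, once
    bounded by \<open>(8 * R / e)\<^sup>2 * c\<^sup>2\<close>, is \<open>real n * \<mu> / 4\<close>.
    The smallness level \<open>\<delta>\<^sup>2 * \<mu> / 4\<close> used next makes the Chebyshev
    term \<open>real n * \<mu> / 4\<close> as well, so the two bounds add up to half of the mean
    count.\<close>
  define \<delta> where "\<delta> = e * sqrt \<mu> / (16 * c)"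
  have p: "\<mu> > 0" "c > 0" "\<delta> > 0" using pos e(1) by (auto simp: \<mu>_def c_def \<delta>_def add_pos_pos)
  have "\<exists>\<^sub>F n in sequentially. (\<Sum>k<n. \<integral>\<^sup>+x. ennreal ((cmod (fst (g k x)))\<^sup>2) \<partial>N)
      \<le> ennreal (\<delta>\<^sup>2 * \<mu> / 4 * (real n)\<^sup>2)"
    unfolding g_def by (rule small) (use p in auto)
  \<comment> \<open>The lower bound on \<open>n\<close> gives \<open>4 * R / e \<ge> 2\<close>,
    which absorbs the summand 2 in the packing bound; the extra 1 makes \<open>n\<close>
    positive.\<close>
  then obtain n where n: "n \<ge> nat \<lceil>(e / (2 * \<delta>))\<^sup>2\<rceil> + 1"
    "(\<Sum>k<n. \<integral>\<^sup>+x. ennreal ((cmod (fst (g k x)))\<^sup>2) \<partial>N) \<le> ennreal (\<delta>\<^sup>2 * \<mu> / 4 * (real n)\<^sup>2)"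
    unfolding frequently_sequentially by blast
  have n0: "real n > 0" and "real n \<ge> (e / (2 * \<delta>))\<^sup>2" using n(1) by linarith+
  then have sq: "sqrt n \<ge> e / (2 * \<delta>)" by (simp add: real_le_rsqrt)
  define R where "R = \<delta> * sqrt n"
  have R: "R > 0" using p n0 by (simp add: R_def)
  define Q where "Q = (4 * R / e + 2)\<^sup>2 * c\<^sup>2"
  have "ennreal (real n * \<mu>) \<le> ennreal Q + (\<Sum>k<n. \<integral>\<^sup>+x. ennreal ((cmod (fst (g k x)))\<^sup>2) \<partial>N) * ennreal (1 / R\<^sup>2)"
    using main[OF R, of n] unfolding Q_def c_def \<mu>_def .
  also have "\<dots> \<le> ennreal Q + ennreal (\<delta>\<^sup>2 * \<mu> / 4 * (real n)\<^sup>2) * ennreal (1 / R\<^sup>2)"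
    using n(2) by (intro add_left_mono mult_right_mono) auto
  also have "ennreal (\<delta>\<^sup>2 * \<mu> / 4 * (real n)\<^sup>2) * ennreal (1 / R\<^sup>2) = ennreal (\<delta>\<^sup>2 * \<mu> / 4 * (real n)\<^sup>2 * (1 / R\<^sup>2))"
    using p by (intro ennreal_mult[symmetric]) auto
  also have "\<delta>\<^sup>2 * \<mu> / 4 * (real n)\<^sup>2 * (1 / R\<^sup>2) = real n * \<mu> / 4"
    using p n0 by (simp add: R_def power_mult_distrib field_simps power2_eq_square)
  also have "ennreal Q + ennreal (real n * \<mu> / 4) = ennreal (Q + real n * \<mu> / 4)"
    using p by (intro ennreal_plus[symmetric]) (auto simp: Q_def)
  finally have le: "real n * \<mu> \<le> Q + real n * \<mu> / 4"
    using p by (subst (asm) ennreal_le_iff) (auto simp: Q_def)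
  have "Q \<le> (8 * R / e)\<^sup>2 * c\<^sup>2"
    unfolding Q_def
  proof (intro mult_right_mono power_mono)
    have "2 \<le> 4 * R / e" using sq p e(1) by (simp add: R_def field_simps)
    then show "4 * R / e + 2 \<le> 8 * R / e" by simp
  qed (use R e(1) in auto)
  also have "\<dots> = real n * \<mu> / 4"
    using p n0 e(1) by (simp add: R_def \<delta>_def power_mult_distrib power_divide field_simps)
  finally have "Q \<le> real n * \<mu> / 4" .
  moreover have "real n * \<mu> > 0" using p n0 by simp
  ultimately show False using le by linarith
qed

section \<open>Second moments and the spectral measure\<close>

text \<open>Both integrals apply the path functional \<open>?h\<close> to the law of the process,
  once shifted by \<open>l\<close> and once unshifted.\<close>

lemma stationary_covariance:
  assumes "stationary_process M X"
  shows "(LINT x|M. X k x * cnj (X l x)) = (LINT x|M. X (k - l) x * cnj (X 0 x))"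
proof -
  let ?Q = "Pi\<^sub>M (UNIV::int set) (\<lambda>_. borel :: complex measure)"
  let ?h = "\<lambda>\<omega> :: int \<Rightarrow> complex. \<omega> (k - l) * cnj (\<omega> 0)"
  have X: "X i \<in> borel_measurable M" for i
    using assms by (auto simp: stationary_process_def)
  have mX: "(\<lambda>x i. X (i + j) x) \<in> measurable M ?Q" for j
    by (rule measurable_PiM_single') (simp_all add: X)
  have c: "(\<lambda>\<omega>. \<omega> i) \<in> borel_measurable ?Q" for i
    by (rule measurable_component_singleton) simp
  have cn: "cnj \<in> borel_measurable borel"
    by (intro borel_measurable_continuous_onI continuous_intros)
  have h: "?h \<in> borel_measurable ?Q"
    by (intro borel_measurable_times c measurable_compose[OF c cn])
  have "(LINT x|M. X k x * cnj (X l x)) = (LINT \<omega>|distr M ?Q (\<lambda>x i. X (i + l) x). ?h \<omega>)"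
    by (simp add: integral_distr[OF mX h])
  also have "distr M ?Q (\<lambda>x i. X (i + l) x) = distr M ?Q (\<lambda>x i. X (i + 0) x)"
    using assms by (simp add: stationary_process_def)
  also have "(LINT \<omega>|\<dots>. ?h \<omega>) = (LINT x|M. X (k - l) x * cnj (X 0 x))"
    by (subst integral_distr[OF mX h]) simp
  finally show ?thesis .
qed

lemma norm_square_sum:
  fixes a :: "nat \<Rightarrow> complex"
  shows "complex_of_real ((cmod (\<Sum>k<n. a k))\<^sup>2) = (\<Sum>k<n. \<Sum>l<n. a k * cnj (a l))"
  by (simp only: complex_norm_square cnj_sum sum_product)

lemma power_int_diff_circle:
  assumes "cmod z = 1"
  shows "z powi (int k - int l) = z ^ k * cnj (z ^ l)"
proof -
  have nz: "z \<noteq> 0" using assms by auto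
  have "z * cnj z = 1" using assms by (simp flip: complex_norm_square)
  then have "z ^ l * cnj z ^ l = 1" by (metis power_mult_distrib power_one)
  then show ?thesis using nz by (simp add: power_int_diff field_simps)
qed

text \<open>The isometry taking \<open>X k\<close> to \<open>z ^ k\<close>: expanding both squares
  gives double sums with the same coefficients, and by stationarity the covariances depend only on
  the lag \<open>k - l\<close>, where they are the Fourier coefficients of \<open>m\<close>.\<close>

lemma spectral_isometry:
  fixes c :: "nat \<Rightarrow> complex"
  assumes st: "stationary_process M X" and L2: "\<And>k. integrable M (\<lambda>x. (cmod (X k x))\<^sup>2)"
    and sp: "spectral_measure M X m"
  shows "(\<integral>\<^sup>+x. ennreal ((cmod (\<Sum>k<n. c k * X (int k) x))\<^sup>2) \<partial>M)
       = (\<integral>\<^sup>+z. ennreal ((cmod (\<Sum>k<n. c k * z ^ k))\<^sup>2) \<partial>m)"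
proof -
  have X [measurable]: "X i \<in> borel_measurable M" for i
    using st by (auto simp: stationary_process_def)
  have "finite_measure m" and sm: "sets m = sets circle_borel"
    and cov: "\<And>k. (LINT x|M. X k x * cnj (X 0 x)) = (LINT z|m. z powi k)"
    using sp by (auto simp: spectral_measure_def)
  interpret finite_measure m by fact
  have spm: "space m = sphere 0 1"
    using sets_eq_imp_space_eq[OF sm] by (simp add: circle_borel_def space_restrict_space)
  have id [measurable]: "(\<lambda>z. z) \<in> borel_measurable m"
    by (subst measurable_cong_sets[OF sm refl])
      (auto simp: circle_borel_def intro: measurable_restrict_space1)
  have cn [measurable]: "cnj \<in> borel_measurable borel"
    by (intro borel_measurable_continuous_onI continuous_intros)
  have iX: "integrable M (\<lambda>x. X k x * cnj (X l x))" for k l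
  proof (rule Bochner_Integration.integrable_bound)
    show "integrable M (\<lambda>x. (cmod (X k x))\<^sup>2 + (cmod (X l x))\<^sup>2)" using L2 by simp
    have "cmod a * cmod b \<le> (cmod a)\<^sup>2 + (cmod b)\<^sup>2" for a b
      using sum_squares_bound[of "cmod a" "cmod b"] mult_nonneg_nonneg[OF norm_ge_zero norm_ge_zero, of a b]
      unfolding mult.assoc by linarith
    then show "AE x in M. norm (X k x * cnj (X l x)) \<le> norm ((cmod (X k x))\<^sup>2 + (cmod (X l x))\<^sup>2)"
      by (simp add: norm_mult)
  qed simp
  have iz: "integrable m (\<lambda>z. z ^ k * cnj (z ^ l))" for k l
    by (rule integrable_const_bound[where B = 1]) (auto simp: spm norm_mult norm_power)
  have rX: "c k * X (int k) x * cnj (c l * X (int l) x) = c k * cnj (c l) * (X (int k) x * cnj (X (int l) x))"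
    for k l x by simp
  have rz: "c k * z ^ k * cnj (c l * z ^ l) = c k * cnj (c l) * (z ^ k * cnj (z ^ l))" for k l z
    by simp
  have eq: "(LINT x|M. X (int k) x * cnj (X (int l) x)) = (LINT z|m. z ^ k * cnj (z ^ l))" for k l
  proof -
    have "(LINT x|M. X (int k) x * cnj (X (int l) x)) = (LINT z|m. z powi (int k - int l))"
      by (simp only: stationary_covariance[OF st, of "int k" "int l"] cov)
    also have "\<dots> = (LINT z|m. z ^ k * cnj (z ^ l))"
      by (intro Bochner_Integration.integral_cong refl power_int_diff_circle) (simp add: spm)
    finally show ?thesis .
  qed
  have cX: "complex_of_real ((cmod (\<Sum>k<n. c k * X (int k) x))\<^sup>2)
      = (\<Sum>k<n. \<Sum>l<n. c k * cnj (c l) * (X (int k) x * cnj (X (int l) x)))" for x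
    unfolding norm_square_sum rX ..
  have cz: "complex_of_real ((cmod (\<Sum>k<n. c k * z ^ k))\<^sup>2)
      = (\<Sum>k<n. \<Sum>l<n. c k * cnj (c l) * (z ^ k * cnj (z ^ l)))" for z
    unfolding norm_square_sum rz ..
  have "integrable M (\<lambda>x. complex_of_real ((cmod (\<Sum>k<n. c k * X (int k) x))\<^sup>2))"
    unfolding cX using iX by simp
  then have 1: "integrable M (\<lambda>x. (cmod (\<Sum>k<n. c k * X (int k) x))\<^sup>2)"
    by (simp only: complex_of_real_integrable_eq)
  have "integrable m (\<lambda>z. complex_of_real ((cmod (\<Sum>k<n. c k * z ^ k))\<^sup>2))"
    unfolding cz using iz by simp
  then have 2: "integrable m (\<lambda>z. (cmod (\<Sum>k<n. c k * z ^ k))\<^sup>2)"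
    by (simp only: complex_of_real_integrable_eq)
  have "complex_of_real (LINT x|M. (cmod (\<Sum>k<n. c k * X (int k) x))\<^sup>2)
      = complex_of_real (LINT z|m. (cmod (\<Sum>k<n. c k * z ^ k))\<^sup>2)"
    unfolding integral_complex_of_real[symmetric] cX cz
    using iX iz by (simp add: Bochner_Integration.integral_sum eq)
  then have "(LINT x|M. (cmod (\<Sum>k<n. c k * X (int k) x))\<^sup>2) = (LINT z|m. (cmod (\<Sum>k<n. c k * z ^ k))\<^sup>2)"
    by (simp only: of_real_eq_iff)
  then show ?thesis
    using nn_integral_eq_integral[OF 1] nn_integral_eq_integral[OF 2] by simp
qed

section \<open>Estimates for the squared Dirichlet kernel\<close>

text \<open>On the unit circle this is \<open>n\<close> times the Fejer kernel.\<close>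

definition dirichlet_square :: "nat \<Rightarrow> complex \<Rightarrow> real" where
  "dirichlet_square n z = (cmod (\<Sum>k<n. z ^ k))\<^sup>2"

lemma dirichlet_square_nonneg: "dirichlet_square n z \<ge> 0"
  by (simp add: dirichlet_square_def)

text \<open>The outer phase in \<open>rotated_sum\<close> has modulus 1 and drops out; the weights
  \<open>cis (- \<beta> * real k)\<close> turn \<open>z ^ k\<close> into a power of
  \<open>z * cis (- \<beta>)\<close>.\<close>

lemma second_moment_rotated_sum:
  assumes "stationary_process M X" "\<And>k. integrable M (\<lambda>x. (cmod (X k x))\<^sup>2)" "spectral_measure M X m"
  shows "(\<integral>\<^sup>+x. ennreal ((cmod (rotated_sum X \<beta> n x))\<^sup>2) \<partial>M)
       = (\<integral>\<^sup>+z. ennreal (dirichlet_square n (z * cis (- \<beta>))) \<partial>m)"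
proof -
  have "cmod (rotated_sum X \<beta> n x) = cmod (\<Sum>k<n. cis (- \<beta> * real k) * X (int k) x)" for x
    by (simp add: rotated_sum_def norm_mult mult.commute)
  moreover have "(\<Sum>k<n. (z * cis (- \<beta>)) ^ k) = (\<Sum>k<n. cis (- \<beta> * real k) * z ^ k)" for z
    by (simp add: power_mult_distrib Complex.DeMoivre mult.commute)
  ultimately show ?thesis
    using spectral_isometry[OF assms, where n = n and c = "\<lambda>k. cis (- \<beta> * real k)"] by (simp only: dirichlet_square_def)
qed

text \<open>Summing the geometric series leaves a numerator of modulus at most 2, so the bound does
  not grow with \<open>n\<close>.\<close>

lemma dirichlet_square_le:
  assumes "cmod z = 1" "0 < d" "d \<le> cmod (z - 1)"
  shows "dirichlet_square n z \<le> 4 / d\<^sup>2"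
proof -
  have nz: "z \<noteq> 1" using assms by auto
  have "cmod (\<Sum>k<n. z ^ k) = cmod (z ^ n - 1) / cmod (z - 1)"
    using nz by (simp add: geometric_sum norm_divide)
  also have "\<dots> \<le> 2 / d"
    using assms norm_triangle_ineq4[of "z ^ n" 1] by (intro frac_le) (auto simp: norm_power)
  finally have "dirichlet_square n z \<le> (2 / d)\<^sup>2"
    unfolding dirichlet_square_def by (rule power_mono) simp
  then show ?thesis by (simp add: power_divide)
qed

lemma has_integral_cis_int:
  "((\<lambda>\<beta>. cis (of_int j * \<beta>)) has_integral (if j = 0 then complex_of_real (2 * pi) else 0)) {0..2 * pi}"
proof (cases "j = 0")
  case True
  then show ?thesis using has_integral_const_real[of "1::complex" 0 "2 * pi"] by (simp add: scaleR_conv_of_real)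
next
  case False
  have "((\<lambda>\<beta>. cis (of_int j * \<beta>)) has_integral
      cis (of_int j * (2 * pi)) / (\<i> * of_int j) - cis (of_int j * 0) / (\<i> * of_int j)) {0..2 * pi}"
  proof (rule fundamental_theorem_of_calculus)
    fix x :: real
    show "((\<lambda>\<beta>. cis (of_int j * \<beta>) / (\<i> * of_int j)) has_vector_derivative cis (of_int j * x))
      (at x within {0..2 * pi})"
      unfolding has_vector_derivative_def using False
      by (auto intro!: derivative_eq_intros simp: scaleR_conv_of_real field_simps)
  qed simp
  moreover have "cis (of_int j * (2 * pi)) = 1"
    by (metis Ints_of_int cis_multiple_2pi mult.assoc mult.commute)
  ultimately show ?thesis using False by simp
qed

text \<open>Orthogonality of the characters: of the expanded square only the \<open>n\<close>
  diagonal terms survive integration over \<beta>, each contributing \<open>2 * pi\<close>.\<close>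

lemma nn_integral_dirichlet_square_le:
  assumes "cmod z = 1"
  shows "(\<integral>\<^sup>+\<beta>. ennreal (dirichlet_square n (z * cis (- \<beta>))) * indicator {0..<2 * pi} \<beta> \<partial>lborel)
    \<le> ennreal (2 * pi * real n)"
proof -
  have *: "complex_of_real (dirichlet_square n (z * cis (- \<beta>)))
     = (\<Sum>k<n. \<Sum>l<n. z ^ k * cnj (z ^ l) * cis (of_int (int l - int k) * \<beta>))" for \<beta>
  proof -
    have "(z * cis (- \<beta>)) ^ k * cnj ((z * cis (- \<beta>)) ^ l)
       = z ^ k * cnj (z ^ l) * cis (of_int (int l - int k) * \<beta>)" for k l
    proof -
      have "cis (real k * (- \<beta>)) * cis (real l * \<beta>) = cis (of_int (int l - int k) * \<beta>)"
        by (simp add: cis_mult algebra_simps)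
      then show ?thesis by (simp add: power_mult_distrib Complex.DeMoivre cis_cnj)
    qed
    then show ?thesis unfolding dirichlet_square_def norm_square_sum by simp
  qed
  have "((\<lambda>\<beta>. complex_of_real (dirichlet_square n (z * cis (- \<beta>)))) has_integral
     (\<Sum>k<n. \<Sum>l<n. z ^ k * cnj (z ^ l) * (if int l - int k = 0 then complex_of_real (2 * pi) else 0))) {0..2 * pi}"
    unfolding * by (intro has_integral_sum has_integral_mult_right has_integral_cis_int) auto
  also have "(\<Sum>k<n. \<Sum>l<n. z ^ k * cnj (z ^ l) * (if int l - int k = 0 then complex_of_real (2 * pi) else 0))
     = (\<Sum>k<n. z ^ k * cnj (z ^ k) * complex_of_real (2 * pi))"
    by (intro sum.cong) (auto simp: if_distrib sum.delta cong: if_cong)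
  also have "\<dots> = complex_of_real (2 * pi * real n)"
    using assms power_int_diff_circle[OF assms, of k k for k] by simp
  finally have "((\<lambda>\<beta>. complex_of_real (dirichlet_square n (z * cis (- \<beta>)))) has_integral
     complex_of_real (2 * pi * real n)) {0..2 * pi}" .
  from has_integral_Re[OF this]
  have "((\<lambda>\<beta>. dirichlet_square n (z * cis (- \<beta>))) has_integral 2 * pi * real n) {0..2 * pi}"
    by simp
  then have "(\<integral>\<^sup>+\<beta>. indicator {0..2 * pi} \<beta> * dirichlet_square n (z * cis (- \<beta>)) \<partial>lborel) = ennreal (2 * pi * real n)"
    by (intro nn_integral_has_integral_lebesgue) (simp_all add: dirichlet_square_nonneg)
  moreover have "(\<integral>\<^sup>+\<beta>. ennreal (dirichlet_square n (z * cis (- \<beta>))) * indicator {0..<2 * pi} \<beta> \<partial>lborel)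
    \<le> (\<integral>\<^sup>+\<beta>. indicator {0..2 * pi} \<beta> * dirichlet_square n (z * cis (- \<beta>)) \<partial>lborel)"
    by (intro nn_integral_mono) (auto simp: indicator_def)
  ultimately show ?thesis by simp
qed

section \<open>Singular spectrum\<close>

text \<open>Used to discard the contribution of order \<open>1 / n\<close> from the compact
  set.\<close>

lemma liminf_add_null_le:
  fixes b :: "nat \<Rightarrow> ennreal" and c :: "nat \<Rightarrow> real"
  assumes "c \<longlonglongrightarrow> 0" and le: "\<And>n. a n \<le> ennreal (c n) + b n"
  shows "liminf a \<le> liminf b"
proof (rule ennreal_le_epsilon)
  fix e :: real assume e: "0 < e"
  have "\<forall>\<^sub>F n in sequentially. c n < e" using order_tendstoD(2)[OF assms(1) e] .
  then have "\<forall>\<^sub>F n in sequentially. a n \<le> b n + ennreal e"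
  proof eventually_elim
    case (elim n)
    then have "ennreal (c n) + b n \<le> ennreal e + b n" by (intro add_right_mono ennreal_leI) simp
    from order_trans[OF le this] show ?case by (simp only: add.commute)
  qed
  then have "liminf a \<le> liminf (\<lambda>n. b n + ennreal e)" by (rule Liminf_mono)
  also have "\<dots> = liminf b + ennreal e" by (rule Liminf_add_const) simp
  finally show "liminf a \<le> liminf b + ennreal e" .
qed

lemma compact_approx:
  fixes \<mu> :: "'c::{second_countable_topology, complete_space} measure"
  assumes "finite_measure \<mu>" "sets \<mu> = sets borel" "C \<in> sets borel" "\<epsilon> > 0"
  obtains K where "K \<subseteq> C" "compact K" "emeasure \<mu> (C - K) \<le> ennreal \<epsilon>"
proof (cases "emeasure \<mu> C = 0")
  case True
  then show thesis by (intro that[of "{}"]) auto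
next
  case False
  interpret finite_measure \<mu> by fact
  \<comment> \<open>The strict inequality, needed to choose \<open>K\<close> from the supremum,
    fails for a null set, where truncated subtraction gives 0; hence the separate case.\<close>
  have "emeasure \<mu> C - ennreal \<epsilon> < emeasure \<mu> C"
    using False assms(4) by (intro ennreal_between) (auto simp: emeasure_eq_measure zero_less_iff_neq_zero)
  also have "emeasure \<mu> C = (SUP K \<in> {K. K \<subseteq> C \<and> compact K}. emeasure \<mu> K)"
    using assms by (intro inner_regular) auto
  finally obtain K where K: "K \<subseteq> C" "compact K" "emeasure \<mu> C - ennreal \<epsilon> < emeasure \<mu> K"
    by (auto simp: less_SUP_iff)
  then have "K \<in> sets \<mu>" using assms(2) borel_compact by blast
  then have "emeasure \<mu> (C - K) = emeasure \<mu> C - emeasure \<mu> K"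
    using K assms by (intro emeasure_Diff) auto
  also have "\<dots> \<le> ennreal \<epsilon>"
    using K(3) by (metis ennreal_minus_le_iff add.commute less_imp_le emeasure_finite top.not_eq_extremum)
  finally show thesis using K that by blast
qed

text \<open>Integrated against the spectral measure, \<open>z \<mapsto> mean_kernel n (z e\<^sup>-\<^sup>i\<^sup>\<beta>)\<close> gives
  \<open>n\<^sup>-\<^sup>2 \<Sum>\<^bsub>k<n\<^esub> E\<bar>S\<^sub>k\<bar>\<^sup>2\<close>.\<close>

definition mean_kernel :: "nat \<Rightarrow> complex \<Rightarrow> real" where
  "mean_kernel n z = (\<Sum>k<n. dirichlet_square k z) / (real n)\<^sup>2"

section \<open>Bounds for the averaged kernel\<close>

lemma mean_kernel_nonneg: "mean_kernel n z \<ge> 0"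
  by (simp add: mean_kernel_def dirichlet_square_nonneg sum_nonneg)

lemma continuous_on_mean_kernel: "continuous_on UNIV (mean_kernel n)"
proof -
  have cont: "continuous_on UNIV (dirichlet_square k)" for k
    unfolding dirichlet_square_def by (intro continuous_intros)
  have eq: "mean_kernel n = (\<lambda>z. (\<Sum>k<n. dirichlet_square k z) * (1 / (real n)\<^sup>2))"
    by (simp add: mean_kernel_def fun_eq_iff)
  show ?thesis
    unfolding eq by (intro continuous_on_mult continuous_on_sum continuous_on_const cont)
qed

lemma mean_kernel_le:
  assumes "cmod z = 1" "0 < d" "d \<le> cmod (z - 1)"
  shows "mean_kernel n z \<le> 4 / d\<^sup>2 / real n"
proof -
  have "(\<Sum>k<n. dirichlet_square k z) \<le> (\<Sum>k<n. 4 / d\<^sup>2)"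
    by (intro sum_mono dirichlet_square_le[OF assms])
  then have le: "mean_kernel n z \<le> real n * (4 / d\<^sup>2) / (real n)\<^sup>2"
    unfolding mean_kernel_def by (intro divide_right_mono) auto
  note le
  \<comment> \<open>At \<open>n = 0\<close> both sides are 0, as division by zero yields 0.\<close>
  also have "real n * (4 / d\<^sup>2) / (real n)\<^sup>2 = 4 / d\<^sup>2 / real n" by (cases "n = 0") (simp_all add: power2_eq_square)
  finally show ?thesis .
qed

text \<open>Each of the \<open>n\<close> summands has \<beta>-integral at most
  \<open>2 * pi * real n\<close>, so the normalisation by \<open>(real n)\<^sup>2\<close> makes the
  bound uniform in \<open>n\<close>, as required for the use of Fatou's lemma.\<close>

lemma nn_integral_mean_kernel_le:
  assumes "cmod z = 1"
  shows "(\<integral>\<^sup>+\<beta>. ennreal (mean_kernel n (z * cis (- \<beta>))) * indicator {0..<2 * pi} \<beta> \<partial>lborel) \<le> ennreal (2 * pi)"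
proof -
  have cont: "continuous_on UNIV (\<lambda>\<beta>. dirichlet_square k (z * cis (- \<beta>)))" for k
    unfolding dirichlet_square_def by (intro continuous_intros)
  have m [measurable]: "(\<lambda>\<beta>. dirichlet_square k (z * cis (- \<beta>))) \<in> borel_measurable borel" for k
    by (rule borel_measurable_continuous_onI[OF cont])
  have "ennreal (mean_kernel n (z * cis (- \<beta>))) * indicator {0..<2 * pi} \<beta> =
     (\<Sum>k<n. ennreal (dirichlet_square k (z * cis (- \<beta>))) * indicator {0..<2 * pi} \<beta>) * ennreal (1 / (real n)\<^sup>2)" for \<beta>
    by (simp add: mean_kernel_def indicator_def sum_ennreal dirichlet_square_nonneg sum_nonneg
        flip: ennreal_mult)
  then have "(\<integral>\<^sup>+\<beta>. ennreal (mean_kernel n (z * cis (- \<beta>))) * indicator {0..<2 * pi} \<beta> \<partial>lborel)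
    = (\<Sum>k<n. \<integral>\<^sup>+\<beta>. ennreal (dirichlet_square k (z * cis (- \<beta>))) * indicator {0..<2 * pi} \<beta> \<partial>lborel) * ennreal (1 / (real n)\<^sup>2)"
    by (simp only:) (subst nn_integral_multc, measurable, subst nn_integral_sum, measurable)
  also have "\<dots> \<le> (\<Sum>k<n. ennreal (2 * pi * real n)) * ennreal (1 / (real n)\<^sup>2)"
  proof (intro mult_right_mono sum_mono)
    fix k assume "k \<in> {..<n}"
    then have "ennreal (2 * pi * real k) \<le> ennreal (2 * pi * real n)"
      by (intro ennreal_leI mult_left_mono) auto
    then show "(\<integral>\<^sup>+\<beta>. ennreal (dirichlet_square k (z * cis (- \<beta>))) * indicator {0..<2 * pi} \<beta> \<partial>lborel) \<le> ennreal (2 * pi * real n)"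
      using nn_integral_dirichlet_square_le[OF assms] order_trans by blast
  qed simp
  also have "(\<Sum>k<n. ennreal (2 * pi * real n)) = ennreal (\<Sum>k<n. 2 * pi * real n)"
    by (rule sum_ennreal) simp
  also have "\<dots> * ennreal (1 / (real n)\<^sup>2) = ennreal (2 * pi * (real n)\<^sup>2 * (1 / (real n)\<^sup>2))"
    by (simp add: power2_eq_square algebra_simps flip: ennreal_mult)
  also have "\<dots> \<le> ennreal (2 * pi)" by (intro ennreal_leI) (simp add: divide_le_eq)
  finally show ?thesis .
qed

section \<open>Vanishing liminf for singular measures\<close>

text \<open>A compact part of \<open>C\<close> contributes nothing to the liminf at almost every
  \<beta>, so only the remaining mass, at most \<open>\<epsilon>\<close>, is integrated. The left
  side does not involve \<open>\<epsilon>\<close>, so the bound can be pushed to 0.\<close>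

lemma nn_integral_liminf_mean_kernel_le:
  assumes "finite_measure \<mu>" and s: "sets \<mu> = sets (borel :: complex measure)"
    and C: "C \<in> sets borel" "C \<subseteq> sphere 0 1" "AE z in \<mu>. z \<in> C"
    and null: "AE \<beta> in lborel. \<beta> \<in> {0..<2 * pi} \<longrightarrow> cis \<beta> \<notin> C" and "\<epsilon> > 0"
  shows "(\<integral>\<^sup>+\<beta>. liminf (\<lambda>n. \<integral>\<^sup>+z. ennreal (mean_kernel n (z * cis (- \<beta>))) \<partial>\<mu>) * indicator {0..<2 * pi} \<beta> \<partial>lborel)
    \<le> ennreal (2 * pi * \<epsilon>)"
proof -
  interpret finite_measure \<mu> by fact
  interpret pair_sigma_finite lborel \<mu> ..
  note s [measurable_cong]
  obtain K where K: "K \<subseteq> C" "compact K" "emeasure \<mu> (C - K) \<le> ennreal \<epsilon>"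
    using compact_approx[OF assms(1) s C(1) assms(7)] .
  have Ks: "K \<in> sets borel" using K(2) by (rule borel_compact)
  have CKs [measurable]: "C - K \<in> sets borel" using C(1) Ks by blast
  have "continuous_on UNIV (\<lambda>p. mean_kernel n (snd p * cis (- fst p)))" for n
    by (rule continuous_on_compose2[OF continuous_on_mean_kernel]) (auto intro!: continuous_intros)
  then have "(\<lambda>p. mean_kernel n (snd p * cis (- fst p))) \<in> borel_measurable borel" for n
    by (rule borel_measurable_continuous_onI)
  then have km [measurable]: "(\<lambda>(\<beta>, z). mean_kernel n (z * cis (- \<beta>))) \<in> borel_measurable (borel \<Otimes>\<^sub>M borel)" for n
    by (simp add: borel_prod case_prod_unfold)
  define b where "b n \<beta> = (\<integral>\<^sup>+z. ennreal (mean_kernel n (z * cis (- \<beta>))) * indicator (C - K) z \<partial>\<mu>)" for n \<beta>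
  have [measurable]: "b n \<in> borel_measurable borel" for n
    unfolding b_def by measurable
  have "liminf (\<lambda>n. \<integral>\<^sup>+z. ennreal (mean_kernel n (z * cis (- \<beta>))) \<partial>\<mu>) \<le> liminf (\<lambda>n. b n \<beta>)"
    if "cis \<beta> \<notin> C" for \<beta>
  proof -
    \<comment> \<open>Compactness turns \<open>cis \<beta> \<notin> K\<close> into a positive
      distance \<open>d\<close>. It depends on \<beta>, which is harmless: the liminf is compared
      separately at each \<beta>.\<close>
    have "cis \<beta> \<notin> K" using K(1) that by blast
    moreover have "open (- K)" using K(2) compact_imp_closed by blast
    ultimately obtain d where d: "d > 0" "ball (cis \<beta>) d \<subseteq> - K"
      using open_contains_ball by (metis ComplI)
    show ?thesis
    proof (rule liminf_add_null_le)
      show "(\<lambda>n. 4 / d\<^sup>2 / real n * measure \<mu> UNIV) \<longlonglongrightarrow> 0"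
        by (intro tendsto_mult_left_zero lim_const_over_n)
      fix n
      have "AE z in \<mu>. ennreal (mean_kernel n (z * cis (- \<beta>))) \<le>
         ennreal (4 / d\<^sup>2 / real n) + ennreal (mean_kernel n (z * cis (- \<beta>))) * indicator (C - K) z"
        using C(3)
      proof eventually_elim
        case (elim z)
        show ?case
        proof (cases "z \<in> K")
          case True
          \<comment> \<open>Rotating turns the distance from \<open>cis \<beta>\<close> into the
            distance from 1 that \<open>mean_kernel_le\<close> refers to.\<close>
          have "z - cis \<beta> = (z * cis (- \<beta>) - 1) * cis \<beta>"
            by (simp add: algebra_simps cis_mult)
          then have "cmod (z - cis \<beta>) = cmod (z * cis (- \<beta>) - 1)" by (simp add: norm_mult)
          moreover have "d \<le> cmod (z - cis \<beta>)"
            using d(2) True by (force simp: dist_norm norm_minus_commute subset_iff)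
          moreover have "cmod (z * cis (- \<beta>)) = 1" using elim C(2) by (auto simp: norm_mult)
          ultimately have "mean_kernel n (z * cis (- \<beta>)) \<le> 4 / d\<^sup>2 / real n"
            using d(1) by (intro mean_kernel_le) auto
          then show ?thesis using True by (simp add: ennreal_leI)
        next
          case False
          then show ?thesis using elim by simp
        qed
      qed
      then have "(\<integral>\<^sup>+z. ennreal (mean_kernel n (z * cis (- \<beta>))) \<partial>\<mu>) \<le>
         (\<integral>\<^sup>+z. ennreal (4 / d\<^sup>2 / real n) + ennreal (mean_kernel n (z * cis (- \<beta>))) * indicator (C - K) z \<partial>\<mu>)"
        by (rule nn_integral_mono_AE)
      also have "\<dots> = (\<integral>\<^sup>+z. ennreal (4 / d\<^sup>2 / real n) \<partial>\<mu>) + b n \<beta>"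
        unfolding b_def by (rule nn_integral_add) measurable
      also have "(\<integral>\<^sup>+z. ennreal (4 / d\<^sup>2 / real n) \<partial>\<mu>) = ennreal (4 / d\<^sup>2 / real n * measure \<mu> UNIV)"
        unfolding nn_integral_const emeasure_eq_measure sets_eq_imp_space_eq[OF s] space_borel
        by (rule ennreal_mult[symmetric]) auto
      finally show "(\<integral>\<^sup>+z. ennreal (mean_kernel n (z * cis (- \<beta>))) \<partial>\<mu>) \<le>
         ennreal (4 / d\<^sup>2 / real n * measure \<mu> UNIV) + b n \<beta>" .
    qed
  qed
  then have "AE \<beta> in lborel. liminf (\<lambda>n. \<integral>\<^sup>+z. ennreal (mean_kernel n (z * cis (- \<beta>))) \<partial>\<mu>) * indicator {0..<2 * pi} \<beta>
      \<le> liminf (\<lambda>n. b n \<beta> * indicator {0..<2 * pi} \<beta>)"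
    using null by (auto elim!: eventually_mono simp: indicator_def)
  then have "(\<integral>\<^sup>+\<beta>. liminf (\<lambda>n. \<integral>\<^sup>+z. ennreal (mean_kernel n (z * cis (- \<beta>))) \<partial>\<mu>) * indicator {0..<2 * pi} \<beta> \<partial>lborel)
     \<le> (\<integral>\<^sup>+\<beta>. liminf (\<lambda>n. b n \<beta> * indicator {0..<2 * pi} \<beta>) \<partial>lborel)"
    by (rule nn_integral_mono_AE)
  also have "\<dots> \<le> liminf (\<lambda>n. \<integral>\<^sup>+\<beta>. b n \<beta> * indicator {0..<2 * pi} \<beta> \<partial>lborel)"
    by (rule nn_integral_liminf) measurable
  also have "\<dots> \<le> liminf (\<lambda>n. ennreal (2 * pi * \<epsilon>))"
  proof (intro Liminf_mono always_eventually allI)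
    fix n
    have "(\<integral>\<^sup>+\<beta>. b n \<beta> * indicator {0..<2 * pi} \<beta> \<partial>lborel) =
      (\<integral>\<^sup>+\<beta>. \<integral>\<^sup>+z. ennreal (mean_kernel n (z * cis (- \<beta>))) * indicator (C - K) z * indicator {0..<2 * pi} \<beta> \<partial>\<mu> \<partial>lborel)"
      unfolding b_def by (intro nn_integral_cong nn_integral_multc[symmetric]) measurable
    \<comment> \<open>Exchanging the order integrates over \<beta> first, where the kernel has a
      bound uniform in \<open>n\<close> and in \<open>z\<close> on the circle.\<close>
    also have "\<dots> = (\<integral>\<^sup>+z. \<integral>\<^sup>+\<beta>. ennreal (mean_kernel n (z * cis (- \<beta>))) * indicator (C - K) z * indicator {0..<2 * pi} \<beta> \<partial>lborel \<partial>\<mu>)"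
      by (rule Fubini'[symmetric]) measurable
    also have "\<dots> \<le> (\<integral>\<^sup>+z. ennreal (2 * pi) * indicator (C - K) z \<partial>\<mu>)"
    proof (rule nn_integral_mono)
      fix z
      have "(\<integral>\<^sup>+\<beta>. ennreal (mean_kernel n (z * cis (- \<beta>))) * indicator (C - K) z * indicator {0..<2 * pi} \<beta> \<partial>lborel)
        = (if z \<in> C - K then \<integral>\<^sup>+\<beta>. ennreal (mean_kernel n (z * cis (- \<beta>))) * indicator {0..<2 * pi} \<beta> \<partial>lborel else 0)"
        by simp
      then show "(\<integral>\<^sup>+\<beta>. ennreal (mean_kernel n (z * cis (- \<beta>))) * indicator (C - K) z * indicator {0..<2 * pi} \<beta> \<partial>lborel)
         \<le> ennreal (2 * pi) * indicator (C - K) z"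
        using nn_integral_mean_kernel_le[of z n] C(2) by (auto split: if_splits)
    qed
    also have "\<dots> = ennreal (2 * pi) * emeasure \<mu> (C - K)"
      using CKs s by (intro nn_integral_cmult_indicator) auto
    also have "\<dots> \<le> ennreal (2 * pi) * ennreal \<epsilon>" using K(3) by (intro mult_left_mono) auto
    also have "\<dots> = ennreal (2 * pi * \<epsilon>)" using assms(7) by (simp add: ennreal_mult)
    finally show "(\<integral>\<^sup>+\<beta>. b n \<beta> * indicator {0..<2 * pi} \<beta> \<partial>lborel) \<le> ennreal (2 * pi * \<epsilon>)" .
  qed
  finally show ?thesis by (simp add: Liminf_const)
qed

text \<open>The liminf is nonnegative and its integral over \<beta> lies below every positive
  number.\<close>

lemma AE_liminf_mean_kernel:
  assumes "finite_measure m" and sm: "sets m = sets circle_borel"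
    and sing: "mutually_singular m circle_lebesgue"
  shows "AE \<beta> in lborel. \<beta> \<in> {0..<2 * pi} \<longrightarrow>
     liminf (\<lambda>n. \<integral>\<^sup>+z. ennreal (mean_kernel n (z * cis (- \<beta>))) \<partial>m) = 0"
proof -
  interpret finite_measure m by fact
  have spm: "space m = sphere 0 1"
    using sets_eq_imp_space_eq[OF sm] by (simp add: circle_borel_def space_restrict_space)
  have id: "(\<lambda>z. z) \<in> measurable m borel"
    by (subst measurable_cong_sets[OF sm refl])
      (auto simp: circle_borel_def intro: measurable_restrict_space1)
  \<comment> \<open>\<open>compact_approx\<close> works with a measure on all Borel sets of the
    plane, so \<open>m\<close> is pushed forward from the circle.\<close>
  define \<mu> where "\<mu> = distr m borel (\<lambda>z. z)"
  have s: "sets \<mu> = sets borel" by (simp add: \<mu>_def)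
  have f: "finite_measure \<mu>"
    unfolding \<mu>_def by (rule finite_measure_distr[OF id])
  interpret \<mu>: finite_measure \<mu> by fact
  note s [measurable_cong]
  obtain A where A: "A \<in> sets m" "emeasure m A = 0" "emeasure circle_lebesgue (space circle_lebesgue - A) = 0"
    using sing by (auto simp: mutually_singular_def)
  \<comment> \<open>\<open>A\<close> is null for \<open>m\<close> and carries
    \<open>circle_lebesgue\<close>, so its complement in the circle carries \<open>m\<close> and has
    arc length 0.\<close>
  define C where "C = sphere 0 1 - A"
  have "C \<in> sets m" using sets.compl_sets[OF A(1)] spm by (simp add: C_def)
  then have Cc: "C \<in> sets circle_borel" and Cb: "C \<in> sets borel"
    using sm by (auto simp: circle_borel_def sets_restrict_space)
  have "AE z in m. z \<notin> A" using A by (intro AE_not_in) (auto simp: null_sets_def)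
  then have "AE z in m. z \<in> C" using AE_space by eventually_elim (auto simp: C_def spm)
  then have AC: "AE z in \<mu>. z \<in> C"
    unfolding \<mu>_def using Cb by (subst AE_distr_iff[OF id]) auto
  have cm: "cis \<in> measurable (restrict_space lborel {0..<2 * pi}) circle_borel"
  proof -
    have "cis \<in> borel_measurable borel"
      by (intro borel_measurable_continuous_onI continuous_intros)
    then show ?thesis
      by (auto simp: circle_borel_def measurable_restrict_space2_iff intro!: measurable_restrict_space1)
  qed
  have "space circle_lebesgue - A = C"
    by (simp add: circle_lebesgue_def circle_borel_def space_restrict_space C_def)
  then have "AE z in circle_lebesgue. z \<notin> C"
    using A(3) Cc by (intro AE_not_in) (auto simp: null_sets_def circle_lebesgue_def)
  then have "AE \<beta> in restrict_space lborel {0..<2 * pi}. cis \<beta> \<notin> C"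
    unfolding circle_lebesgue_def by (rule AE_distrD[OF cm])
  then have null: "AE \<beta> in lborel. \<beta> \<in> {0..<2 * pi} \<longrightarrow> cis \<beta> \<notin> C"
    by (subst (asm) AE_restrict_space_iff) auto
  define h where "h \<beta> = liminf (\<lambda>n. \<integral>\<^sup>+z. ennreal (mean_kernel n (z * cis (- \<beta>))) \<partial>\<mu>) * indicator {0..<2 * pi} \<beta>" for \<beta>
  have "(\<integral>\<^sup>+\<beta>. h \<beta> \<partial>lborel) \<le> 0"
  proof (rule ennreal_le_epsilon)
    fix e :: real assume "0 < e"
    then have "(\<integral>\<^sup>+\<beta>. h \<beta> \<partial>lborel) \<le> ennreal (2 * pi * (e / (2 * pi)))"
      unfolding h_def using nn_integral_liminf_mean_kernel_le[OF f s Cb _ AC null, of "e / (2 * pi)"]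
      by (auto simp: C_def)
    then show "(\<integral>\<^sup>+\<beta>. h \<beta> \<partial>lborel) \<le> 0 + ennreal e" by simp
  qed
  then have "(\<integral>\<^sup>+\<beta>. h \<beta> \<partial>lborel) = 0" by simp
  moreover have "h \<in> borel_measurable lborel"
  proof -
    have "continuous_on UNIV (\<lambda>p. mean_kernel n (snd p * cis (- fst p)))" for n
      by (rule continuous_on_compose2[OF continuous_on_mean_kernel]) (auto intro!: continuous_intros)
    then have "(\<lambda>p. mean_kernel n (snd p * cis (- fst p))) \<in> borel_measurable borel" for n
      by (rule borel_measurable_continuous_onI)
    then have [measurable]: "(\<lambda>(\<beta>, z). mean_kernel n (z * cis (- \<beta>))) \<in> borel_measurable (borel \<Otimes>\<^sub>M borel)" for n
      by (simp add: borel_prod case_prod_unfold)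
    show ?thesis unfolding h_def by measurable
  qed
  ultimately have "AE \<beta> in lborel. h \<beta> = 0" using nn_integral_0_iff_AE by blast
  moreover have "(\<integral>\<^sup>+z. ennreal (mean_kernel n (z * cis (- \<beta>))) \<partial>\<mu>) = (\<integral>\<^sup>+z. ennreal (mean_kernel n (z * cis (- \<beta>))) \<partial>m)" for n \<beta>
  proof -
    have "continuous_on UNIV (\<lambda>z. mean_kernel n (z * cis (- \<beta>)))"
      by (rule continuous_on_compose2[OF continuous_on_mean_kernel]) (auto intro!: continuous_intros)
    then have "(\<lambda>z. mean_kernel n (z * cis (- \<beta>))) \<in> borel_measurable borel"
      by (rule borel_measurable_continuous_onI)
    then show ?thesis unfolding \<mu>_def by (subst nn_integral_distr[OF id]) simp_all
  qed
  ultimately show ?thesis unfolding h_def by (auto elim!: eventually_mono)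
qed

section \<open>Transfer to realizations of the walk\<close>

lemma frequently_le_of_liminf_zero:
  fixes a :: "nat \<Rightarrow> ennreal"
  assumes "liminf a = 0" "\<eta> > 0"
  shows "\<exists>\<^sub>F n in sequentially. a n \<le> ennreal \<eta>"
proof (rule ccontr)
  assume "\<not> ?thesis"
  then have "\<forall>\<^sub>F n in sequentially. ennreal \<eta> \<le> a n"
    by (auto simp: frequently_def elim!: eventually_mono)
  then have "ennreal \<eta> \<le> liminf a" by (rule Liminf_bounded)
  then show False using assms by simp
qed

lemma sum_nn_integral_dirichlet_square:
  assumes "(\<lambda>z. z) \<in> borel_measurable m"
  shows "(\<Sum>k<n. \<integral>\<^sup>+z. ennreal (dirichlet_square k (z * w)) \<partial>m)
     = (\<integral>\<^sup>+z. ennreal (mean_kernel n (z * w)) \<partial>m) * ennreal ((real n)\<^sup>2)"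
proof -
  have cont: "continuous_on UNIV (\<lambda>z. dirichlet_square k (z * w))" for k
    unfolding dirichlet_square_def by (intro continuous_intros)
  have m [measurable]: "(\<lambda>z. dirichlet_square k (z * w)) \<in> borel_measurable m" for k
    using measurable_compose[OF assms borel_measurable_continuous_onI[OF cont]] .
  have "(\<Sum>k<n. \<integral>\<^sup>+z. ennreal (dirichlet_square k (z * w)) \<partial>m)
     = (\<integral>\<^sup>+z. (\<Sum>k<n. ennreal (dirichlet_square k (z * w))) \<partial>m)"
    by (rule nn_integral_sum[symmetric]) measurable
  also have "\<dots> = (\<integral>\<^sup>+z. ennreal (mean_kernel n (z * w)) * ennreal ((real n)\<^sup>2) \<partial>m)"
  proof (rule nn_integral_cong)
    fix z
    have "(\<Sum>k<n. ennreal (dirichlet_square k (z * w))) = ennreal (\<Sum>k<n. dirichlet_square k (z * w))"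
      by (simp add: sum_ennreal dirichlet_square_nonneg)
    \<comment> \<open>Also valid for \<open>n = 0\<close>, where both sides vanish.\<close>
    also have "(\<Sum>k<n. dirichlet_square k (z * w)) = mean_kernel n (z * w) * (real n)\<^sup>2"
      by (simp add: mean_kernel_def)
    finally show "(\<Sum>k<n. ennreal (dirichlet_square k (z * w))) = ennreal (mean_kernel n (z * w)) * ennreal ((real n)\<^sup>2)"
      by (simp add: ennreal_mult mean_kernel_nonneg)
  qed
  also have "\<dots> = (\<integral>\<^sup>+z. ennreal (mean_kernel n (z * w)) \<partial>m) * ennreal ((real n)\<^sup>2)"
    unfolding mean_kernel_def by (rule nn_integral_multc) measurable
  finally show ?thesis .
qed

text \<open>Both sides integrate the same function of coordinate \<open>k\<close> against the joint
  law shared by the realization and the walk.\<close>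

lemma nn_integral_realization:
  assumes r: "realizes_walk M (rotated_walk X \<beta>) N T f" and X: "\<And>k. X k \<in> borel_measurable M"
  shows "(\<integral>\<^sup>+x. ennreal ((cmod (fst (left_prod (\<lambda>i. f ((T ^^ i) x)) k)))\<^sup>2) \<partial>N)
      = (\<integral>\<^sup>+x. ennreal ((cmod (rotated_sum X \<beta> k x))\<^sup>2) \<partial>M)"
proof (cases "k = 0")
  \<comment> \<open>The joint law is indexed by times \<open>n \<ge> 1\<close>; at time 0 both
    integrands vanish.\<close>
  case True
  then show ?thesis by (simp add: motion_group_one rotated_sum_def)
next
  case False
  let ?Q = "Pi\<^sub>M {1::nat..} (\<lambda>_. motion_borel)"
  have T: "T \<in> measurable N N" and f: "f \<in> measurable N motion_borel"
    and law: "distr N ?Q (\<lambda>x. \<lambda>n\<in>{1..}. cocycle N T f (int n) x) = distr M ?Q (\<lambda>x. \<lambda>n\<in>{1..}. rotated_walk X \<beta> n x)"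
    using r by (auto simp: realizes_walk_def invertible_ppt_def)
  have "(\<lambda>x. left_prod (\<lambda>i. f ((T ^^ i) x)) n) \<in> measurable N motion_borel" for n
    by (rule measurable_left_prod) (rule measurable_compose[OF measurable_funpow[OF T] f])
  then have mN: "(\<lambda>x. \<lambda>n\<in>{1..}. cocycle N T f (int n) x) \<in> measurable N ?Q"
    by (intro measurable_restrict) (simp add: cocycle_def)
  have "(\<lambda>x. (X (int i) x, cis \<beta>)) \<in> measurable M motion_borel" for i
    using X by (auto simp: motion_borel_def measurable_restrict_space2_iff motion_group_carrier
        intro!: borel_measurable_Pair)
  then have mM: "(\<lambda>x. \<lambda>n\<in>{1..}. rotated_walk X \<beta> n x) \<in> measurable M ?Q"
    unfolding rotated_walk_eq_left_prod by (intro measurable_restrict measurable_left_prod)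
  have "continuous_on UNIV (\<lambda>g :: complex \<times> complex. (cmod (fst g))\<^sup>2)"
    by (intro continuous_intros)
  then have "(\<lambda>g :: complex \<times> complex. (cmod (fst g))\<^sup>2) \<in> borel_measurable borel"
    by (rule borel_measurable_continuous_onI)
  then have "(\<lambda>g. (cmod (fst g))\<^sup>2) \<in> borel_measurable motion_borel"
    unfolding motion_borel_def by (rule measurable_restrict_space1)
  then have "(\<lambda>\<omega>. ennreal ((cmod (fst (\<omega> k)))\<^sup>2)) \<in> borel_measurable ?Q"
    using False by (intro measurable_compose[OF _ measurable_ennreal]
        measurable_compose[OF measurable_component_singleton]) auto
  then have hN: "(\<lambda>\<omega>. ennreal ((cmod (fst (\<omega> k)))\<^sup>2)) \<in> borel_measurable (distr N ?Q F)"
    and hM: "(\<lambda>\<omega>. ennreal ((cmod (fst (\<omega> k)))\<^sup>2)) \<in> borel_measurable (distr M ?Q G)" for F G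
    by simp_all
  show ?thesis
    using nn_integral_distr[OF mN hN] nn_integral_distr[OF mM hM] False unfolding law
    by (simp add: cocycle_def rotated_walk_def)
qed

theorem theorem1p2:
  fixes M :: "'a measure" and X :: "int \<Rightarrow> 'a \<Rightarrow> complex" and m :: "complex measure"
  assumes "prob_space M"
    and "stationary_process M X"
    and "ergodic_process M X"
    and "\<And>k. integrable M (\<lambda>x. (cmod (X k x))\<^sup>2)"
    and "spectral_measure M X m"
    and "mutually_singular m circle_lebesgue"
  shows "AE \<beta> in lebesgue_on {0..<2 * pi}.
           \<forall>(N :: 'b measure) T f.
             realizes_walk M (rotated_walk X \<beta>) N T f \<longrightarrow> recurrent N T f"
proof -
  have X: "X k \<in> borel_measurable M" for k
    using assms(2) by (simp add: stationary_process_def)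
  have fin: "finite_measure m" and sm: "sets m = sets circle_borel"
    using assms(5) by (auto simp: spectral_measure_def)
  have id: "(\<lambda>z. z) \<in> borel_measurable m"
    by (subst measurable_cong_sets[OF sm refl])
      (auto simp: circle_borel_def intro: measurable_restrict_space1)
  \<comment> \<open>The condition on \<beta> involves \<open>m\<close> alone, so one exceptional
    null set serves all realizations \<open>(N, T, f)\<close> at once.\<close>
  have rec: "recurrent N T f"
    if zero: "liminf (\<lambda>n. \<integral>\<^sup>+z. ennreal (mean_kernel n (z * cis (- \<beta>))) \<partial>m) = 0"
      and r: "realizes_walk M (rotated_walk X \<beta>) N T f"
    for \<beta> and N :: "'b measure" and T f
  proof (rule recurrent_of_second_moments)
    fix \<eta> :: real assume \<eta>: "\<eta> > 0"
    show "\<exists>\<^sub>F n in sequentially.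
       (\<Sum>k<n. \<integral>\<^sup>+x. ennreal ((cmod (fst (left_prod (\<lambda>i. f ((T ^^ i) x)) k)))\<^sup>2) \<partial>N) \<le> ennreal (\<eta> * (real n)\<^sup>2)"
      \<comment> \<open>The moments pass from the realization to the process, then to the spectral
        measure, and finally to the averaged kernel, whose integral has liminf 0.\<close>
      unfolding nn_integral_realization[OF r X] second_moment_rotated_sum[OF assms(2,4,5)]
        sum_nn_integral_dirichlet_square[OF id]
      using frequently_le_of_liminf_zero[OF zero \<eta>]
      by (rule frequently_elim1) (use \<eta> in \<open>simp add: ennreal_mult mult_right_mono\<close>)
  qed (use r in \<open>auto simp: realizes_walk_def\<close>)
  \<comment> \<open>The statement refers to completed Lebesgue measure, while Fatou's lemma and
    Fubini's theorem were applied over \<open>lborel\<close>.\<close>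
  have "AE \<beta> in lebesgue. \<beta> \<in> {0..<2 * pi} \<longrightarrow>
     liminf (\<lambda>n. \<integral>\<^sup>+z. ennreal (mean_kernel n (z * cis (- \<beta>))) \<partial>m) = 0"
    by (rule AE_completion[OF AE_liminf_mean_kernel[OF fin sm assms(6)]])
  then have "AE \<beta> in lebesgue_on {0..<2 * pi}.
     liminf (\<lambda>n. \<integral>\<^sup>+z. ennreal (mean_kernel n (z * cis (- \<beta>))) \<partial>m) = 0"
    by (subst AE_restrict_space_iff) auto
  then show ?thesis by eventually_elim (use rec in blast)
qed

end
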